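(* Let $\ell\in\mathbb{N}$ and let $\mathfrak{g}^{(\ell)}_{n}:=\sqrt{n}\prod_{j=1}^{\ell-1}(n-j)$ for $n\geq0$ and $\mathfrak{g}^{(\ell)}_{n}:=0$ for $n<0$. Then the weight $\rho^{(\ell)}$ given by $$\rho_{n}^{(\ell)}:=\frac{(-\Delta)^{\ell}\mathfrak{g}_{n}^{(\ell)}}{\mathfrak{g}_{n}^{(\ell)}},\qquad n\geq\ell,$$ is an optimal strictly positive discrete Hardy--Rellich--Birman weight.
   Context: $\mathbb{N}=\{1,2,\dots\}$. All sequences are complex sequences indexed by $\mathbb{Z}$. Difference operators: $(\nabla u)_{n}:=u_{n}-u_{n-1}$, $(\Delta u)_{n}:=u_{n-1}-2u_{n}+u_{n+1}$; we write $(-\Delta)^{j}u_n$ for $((-\Delta)^{j}u)_n$. Half-integer powers: $(-\Delta)^{\ell/2}:=(-\Delta)^{m}$ if $\ell=2m$, and $(-\Delta)^{\ell/2}:=\nabla(-\Delta)^{m}$ if $\ell=2m+1$, with zeroth power equal to the identity. $\lceil x\rceil$ is the least integer $\geq x$. Spaces: $H^{\ell}:=\{u:\mathbb{Z}\to\mathbb{C}\mid u_{n}=0\text{ for all }n<\ell\}$, and $\mathcal{H}_{0}^{\ell}:=\{u\in H^{\ell}\mid u\text{ has finite support}\}$. A nonnegative sequence $\rho=\{\rho_{n}\}_{n=\ell}^{\infty}$ is a discrete Hardy--Rellich--Birman weight (for the given $\ell$) if $$(\ast)\qquad \sum_{n=\lceil\ell/2\rceil}^{\infty}|(-\Delta)^{\ell/2}u_{n}|^{2}\geq\sum_{n=\ell}^{\infty}\rho_{n}|u_{n}|^{2}\quad\text{for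 all }u\in\mathcal{H}_{0}^{\ell}.$$ Such a weight $\rho$ is optimal if the following three properties hold: - (criticality) whenever $(\ast)$ holds with $\rho$ replaced by another weight $\tilde\rho$ with $\tilde\rho_n\geq\rho_n$ for all $n\geq\ell$, then $\tilde\rho_n=\rho_n$ for all $n\geq\ell$; - (non-attainability) whenever the inequality in $(\ast)$ holds as equality for some $u\in H^{\ell}$ such that $\sqrt{\rho}\,u$ is square summable (i.e. the right-hand side of $(\ast)$ is finite), then $u\equiv0$; - (optimality near infinity) for every integer $M\geq\ell$ and every $\varepsilon>0$ there exists $u\in\mathcal{H}_{0}^{M}$ such that $\sum_{n=\lceil\ell/2\rceil}^{\infty}|(-\Delta)^{\ell/2}u_{n}|^{2}<(1+\varepsilon)\sum_{n=\ell}^{\infty}\rho_{n}|u_{n}|^{2}$. *)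

theory Defs
  imports "HOL-Analysis.Analysis"
begin

definition nabla :: "(int \<Rightarrow> 'a::comm_ring_1) \<Rightarrow> int \<Rightarrow> 'a" where
  "nabla u n = u n - u (n - 1)"

definition laplacian :: "(int \<Rightarrow> 'a::comm_ring_1) \<Rightarrow> int \<Rightarrow> 'a" where
  "laplacian u n = u (n - 1) - 2 * u n + u (n + 1)"

definition neg_laplacian :: "(int \<Rightarrow> 'a::comm_ring_1) \<Rightarrow> int \<Rightarrow> 'a" where
  "neg_laplacian u n = - laplacian u n"

definition half_power :: "nat \<Rightarrow> (int \<Rightarrow> 'a::comm_ring_1) \<Rightarrow> int \<Rightarrow> 'a" where
  "half_power l u =
     (if even l then (neg_laplacian ^^ (l div 2)) u
      else nabla ((neg_laplacian ^^ (l div 2)) u))"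

definition H_space :: "int \<Rightarrow> (int \<Rightarrow> complex) set" where
  "H_space k = {u. \<forall>n<k. u n = 0}"

definition H0_space :: "int \<Rightarrow> (int \<Rightarrow> complex) set" where
  "H0_space k = {u \<in> H_space k. finite {n. u n \<noteq> 0}}"

text \<open>
  Both sides of the inequality are sums of nonnegative terms. They are taken in the extended
  nonnegative reals, so that they are also meaningful (possibly infinite) for sequences
  of infinite support.
\<close>

definition energy :: "nat \<Rightarrow> (int \<Rightarrow> complex) \<Rightarrow> ennreal" where
  "energy l u = (\<Sum>\<^sub>\<infinity>n\<in>{\<lceil>real l / 2\<rceil>..}. ennreal ((cmod (half_power l u n))\<^sup>2))"

definition weighted_sum :: "nat \<Rightarrow> (int \<Rightarrow> real) \<Rightarrow> (int \<Rightarrow> complex) \<Rightarrow> ennreal" where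
  "weighted_sum l \<rho> u = (\<Sum>\<^sub>\<infinity>n\<in>{int l..}. ennreal (\<rho> n * (cmod (u n))\<^sup>2))"

text \<open>
  A weight is a sequence indexed by the integers \<open>n \<ge> l\<close>; it is represented by a function on
  all integers whose values at \<open>n < l\<close> are irrelevant.
\<close>

definition hrb_weight :: "nat \<Rightarrow> (int \<Rightarrow> real) \<Rightarrow> bool" where
  "hrb_weight l \<rho> \<longleftrightarrow>
     (\<forall>n\<ge>int l. 0 \<le> \<rho> n) \<and>
     (\<forall>u\<in>H0_space (int l). energy l u \<ge> weighted_sum l \<rho> u)"

definition critical_weight :: "nat \<Rightarrow> (int \<Rightarrow> real) \<Rightarrow> bool" where
  "critical_weight l \<rho> \<longleftrightarrow>
     (\<forall>\<rho>'. hrb_weight l \<rho>' \<and> (\<forall>n\<ge>int l. \<rho>' n \<ge> \<rho> n)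
        \<longrightarrow> (\<forall>n\<ge>int l. \<rho>' n = \<rho> n))"

definition non_attainable_weight :: "nat \<Rightarrow> (int \<Rightarrow> real) \<Rightarrow> bool" where
  "non_attainable_weight l \<rho> \<longleftrightarrow>
     (\<forall>u\<in>H_space (int l).
        (\<lambda>n. (cmod (complex_of_real (sqrt (\<rho> n)) * u n))\<^sup>2) summable_on {int l..} \<and>
        energy l u = weighted_sum l \<rho> u
        \<longrightarrow> (\<forall>n. u n = 0))"

definition optimal_near_infinity :: "nat \<Rightarrow> (int \<Rightarrow> real) \<Rightarrow> bool" where
  "optimal_near_infinity l \<rho> \<longleftrightarrow>
     (\<forall>M\<ge>int l. \<forall>\<epsilon>::real. \<epsilon> > 0 \<longrightarrow>
        (\<exists>u\<in>H0_space M. energy l u < ennreal (1 + \<epsilon>) * weighted_sum l \<rho> u))"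

definition optimal_hrb_weight :: "nat \<Rightarrow> (int \<Rightarrow> real) \<Rightarrow> bool" where
  "optimal_hrb_weight l \<rho> \<longleftrightarrow>
     hrb_weight l \<rho> \<and> critical_weight l \<rho> \<and>
     non_attainable_weight l \<rho> \<and> optimal_near_infinity l \<rho>"

definition g_seq :: "nat \<Rightarrow> int \<Rightarrow> real" where
  "g_seq l n = (if n \<ge> 0 then sqrt (of_int n) * (\<Prod>j\<in>{1..<l}. of_int n - of_nat j) else 0)"

definition rho_weight :: "nat \<Rightarrow> int \<Rightarrow> real" where
  "rho_weight l n = (neg_laplacian ^^ l) (g_seq l) n / g_seq l n"

end

theory Submission
  imports Defs "HOL-Combinatorics.Stirling" "HOL-Library.Groups_Big_Fun"
begin

text \<open>
  Write \<open>\<nabla>\<close> for \<open>nabla\<close>, \<open>g\<close> for \<open>g_seq l\<close> and \<open>\<rho>\<close> for \<open>rho_weight l\<close>. Since \<open>-\<Delta> = -\<nabla>\<^sup>2\<close> up to a shift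
  by one, the energy of a sequence \<open>u\<close> vanishing below \<open>l\<close> is the sum of \<open>|\<nabla>\<^sup>l u\<^sub>n|\<^sup>2\<close> over \<open>n \<ge> l\<close>.

  The inequality. On the continuous half-line the inequality with ground state \<open>g = x^(l-1/2)\<close>
  is a composition of \<open>l\<close> weighted Hardy inequalities, which pass from \<open>u^(l-k)\<close> with weight
  \<open>w\<^sub>k = (-1)^k g^(l+k) / g^(l-k)\<close> to \<open>u^(l-k-1)\<close> with weight \<open>w\<^sub>k\<^sub>+\<^sub>1\<close>. The same chain exists for
  differences, with the lower order differences \<open>profile k = \<nabla>^(l-k) g\<close> in the denominators and
  the signed higher order differences \<open>flux k\<close> in the numerators. One step is Picone's identity
  followed by a summation by parts (\<open>weighted_hardy_step\<close>); it discards only nonnegative terms,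
  even for sequences of infinite support. The chain rests on \<open>g\<close> vanishing
  below \<open>l\<close> and on the positivity of \<open>(-1)^k \<nabla>^(l+k) g\<close> where these differences occur, which is what
  the locale \<open>hrb_ground_state\<close> records.

  Positivity. Expanding the product in \<open>g\<close> with Stirling numbers gives
  \<open>g(x) = \<Sum>k. (-1)^(l+k) stirling l k x^(k-1/2)\<close>. In every derivative of order \<open>i \<ge> l\<close> the sign
  \<open>(-1)^(i+k)\<close> of the falling factor cancels the alternation in \<open>k\<close>, so that all terms have the sign
  \<open>(-1)^(i+l)\<close> (\<open>g_deriv_sign\<close>). A mean value theorem for iterated differences transfers signs
  and sizes from derivatives to differences.

  Non-attainability. If equality holds, then the remainder of the last Hardy step vanishes, which
  forces \<open>u = c g\<close>; but \<open>\<rho> g\<^sup>2\<close> is at least a multiple of \<open>1/n\<close>, hence not summable, so \<open>c = 0\<close>.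

  Criticality and optimality near infinity. Let the deficit be energy minus weighted sum. Scaling
  suggests that cutting \<open>g\<close> off smoothly between \<open>N\<close> and a multiple of \<open>N\<close> costs a deficit
  bounded independently of \<open>N\<close> (\<open>bounded_deficit_cutoffs\<close>). Two cutoffs \<open>u\<close>, \<open>v\<close>, of which \<open>v\<close> still
  equals \<open>g\<close> on a neighbourhood of the support of \<open>u\<close>, are orthogonal for the deficit form, because
  \<open>(-\<Delta>)^l v = \<rho> v\<close> there (\<open>deficit_combination\<close>). Hence averages of \<open>k\<close> widely separated cutoffs have
  a deficit \<open>O(1/k)\<close> while being equal to \<open>g\<close> initially, which leaves no room for a larger weight;
  and differences of two cutoffs live near infinity, have bounded deficit, and have arbitrarily large
  weighted sum.
\<close>

section \<open>Iterated differences\<close>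

lemma nabla_funpow_add:
  "(nabla ^^ m) (\<lambda>n. u n + v n) n = (nabla ^^ m) u n + (nabla ^^ m) v n"
  by (induction m arbitrary: n) (simp_all add: nabla_def)

lemma nabla_funpow_cmult: "(nabla ^^ m) (\<lambda>n. c * u n) n = c * (nabla ^^ m) u n"
  by (induction m arbitrary: n) (simp_all add: nabla_def algebra_simps)

lemma nabla_funpow_shift: "(nabla ^^ m) (\<lambda>n. u (n + c)) n = (nabla ^^ m) u (n + c)"
  by (induction m arbitrary: n) (simp_all add: nabla_def algebra_simps)

lemma nabla_funpow_of_real:
  "(nabla ^^ m) (\<lambda>n. complex_of_real (u n)) n = complex_of_real ((nabla ^^ m) u n)"
  by (induction m arbitrary: n) (simp_all add: nabla_def)

lemma nabla_funpow_cong: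
  assumes "\<And>i. n - int m \<le> i \<Longrightarrow> i \<le> n \<Longrightarrow> u i = v i"
  shows "(nabla ^^ m) u n = (nabla ^^ m) v n"
  using assms by (induction m arbitrary: n) (simp_all add: nabla_def)

lemma nabla_funpow_zero: "(nabla ^^ m) (\<lambda>n. 0) n = 0"
  by (induction m arbitrary: n) (simp_all add: nabla_def)

lemma nabla_funpow_eq_0:
  assumes "\<And>i. i < k \<Longrightarrow> u i = 0" "n < k"
  shows "(nabla ^^ m) u n = 0"
  using nabla_funpow_cong[of n m u "\<lambda>_. 0"] assms by (simp add: nabla_funpow_zero)

lemma finite_support_nabla_funpow:
  assumes "finite {n. u n \<noteq> 0}"
  shows "finite {n. (nabla ^^ m) u n \<noteq> 0}"
proof (induction m)
  case 0
  then show ?case using assms by simp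
next
  case (Suc m)
  let ?A = "{n. (nabla ^^ m) u n \<noteq> 0}"
  have "{n. (nabla ^^ Suc m) u n \<noteq> 0} \<subseteq> ?A \<union> (\<lambda>n. n + 1) ` ?A"
  proof
    fix n assume "n \<in> {n. (nabla ^^ Suc m) u n \<noteq> 0}"
    then have "n \<in> ?A \<or> n - 1 \<in> ?A" by (auto simp: nabla_def)
    then show "n \<in> ?A \<union> (\<lambda>n. n + 1) ` ?A"
    proof
      assume "n - 1 \<in> ?A"
      then have "(n - 1) + 1 \<in> (\<lambda>n. n + 1) ` ?A" by (rule imageI)
      then show ?thesis by simp
    qed simp
  qed
  then show ?case using Suc finite_subset by blast
qed

lemma neg_laplacian_funpow:
  "(neg_laplacian ^^ m) u n = (-1) ^ m * (nabla ^^ (2 * m)) u (n + int m)"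
proof (induction m arbitrary: n)
  case (Suc m)
  define x where "x = (neg_laplacian ^^ m) u"
  define y where "y = (nabla ^^ (2 * m)) u"
  have x: "x i = (-1) ^ m * y (i + int m)" for i
    using Suc by (simp add: x_def y_def)
  have "(neg_laplacian ^^ Suc m) u n = 2 * x n - x (n - 1) - x (n + 1)"
    by (simp add: x_def neg_laplacian_def laplacian_def)
  also have "\<dots> = (-1) ^ Suc m * nabla (nabla y) (n + int (Suc m))"
    by (simp add: x nabla_def algebra_simps)
  also have "nabla (nabla y) = (nabla ^^ (2 * Suc m)) u"
    by (simp add: y_def)
  finally show ?case .
qed simp

text \<open>
  The centred operators are shifted powers of \<open>nabla\<close>; the shift is exactly what moves the lower
  summation bound \<open>\<lceil>l/2\<rceil>\<close> of the energy to \<open>l\<close>.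
\<close>

lemma half_power_eq_nabla_funpow:
  "half_power l u n = (-1) ^ (l div 2) * (nabla ^^ l) u (n + int (l div 2))"
proof (cases "even l")
  case True
  then show ?thesis by (auto simp: half_power_def neg_laplacian_funpow elim!: evenE)
next
  case False
  then obtain m where l: "l = Suc (2 * m)" by (auto elim!: oddE)
  have e: "n - 1 + int m = n + int m - 1" by simp
  show ?thesis
    by (simp add: l half_power_def nabla_def neg_laplacian_funpow e algebra_simps)
qed

text \<open>
  Rolle's argument: \<open>\<nabla> u\<close> interpolates \<open>x \<mapsto> F 0 x - F 0 (x - 1)\<close>, so the induction hypothesis gives
  a point for one order less, and the ordinary mean value theorem resolves the difference of two
  values of a derivative that remains there. Continuity is assumed up to the endpoints and
  differentiability in between, to cover half-integer powers at \<open>0\<close>.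
\<close>

lemma nabla_funpow_mean_value:
  fixes F :: "nat \<Rightarrow> real \<Rightarrow> real"
  assumes "\<And>i. n - int (Suc m) \<le> i \<Longrightarrow> i \<le> n \<Longrightarrow> u i = F 0 (of_int i)"
    and "continuous_on {of_int n - real (Suc m)..of_int n} (F 0)"
    and "\<And>j x. j \<le> m \<Longrightarrow> of_int n - real (Suc m) < x \<Longrightarrow> x < of_int n \<Longrightarrow>
           (F j has_real_derivative F (Suc j) x) (at x)"
  shows "\<exists>x. of_int n - real (Suc m) < x \<and> x < of_int n \<and> (nabla ^^ Suc m) u n = F (Suc m) x"
  using assms
proof (induction m arbitrary: u F)
  case 0
  have c: "continuous_on {of_int n - 1..of_int n} (F 0)" using 0(2) by simp
  have d: "F 0 differentiable at x" if "of_int n - 1 < x" "x < of_int n" for x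
    using 0(3)[of 0 x] that by (auto simp: real_differentiable_def)
  obtain d x where x: "of_int n - 1 < x" "x < of_int n"
    "(F 0 has_real_derivative d) (at x)"
    "F 0 (of_int n) - F 0 (of_int n - 1) = (of_int n - (of_int n - 1)) * d"
    using MVT[OF _ c d] by auto
  then have "d = F 1 x" using 0(3)[of 0 x] DERIV_unique by simp
  with x show ?case using 0(1)[of n] 0(1)[of "n - 1"] by (auto simp: nabla_def)
next
  case (Suc m)
  define F' where "F' = (\<lambda>j x. F j x - F j (x - 1))"
  have "\<exists>x. of_int n - real (Suc m) < x \<and> x < of_int n \<and>
          (nabla ^^ Suc m) (nabla u) n = F' (Suc m) x"
  proof (rule Suc.IH)
    show "nabla u i = F' 0 (of_int i)" if "n - int (Suc m) \<le> i" "i \<le> n" for i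
      using that Suc.prems(1)[of i] Suc.prems(1)[of "i - 1"] by (simp add: nabla_def F'_def)
    show "continuous_on {of_int n - real (Suc m)..of_int n} (F' 0)"
      unfolding F'_def
      by (intro continuous_intros continuous_on_compose2[OF Suc.prems(2)]
            continuous_on_subset[OF Suc.prems(2)]) auto
    show "(F' j has_real_derivative F' (Suc j) x) (at x)"
      if j: "j \<le> m" and x: "of_int n - real (Suc m) < x" "x < of_int n" for j x
    proof -
      have "((\<lambda>x. F j (x - 1)) has_real_derivative F (Suc j) (x - 1) * 1) (at x)"
        by (rule DERIV_chain2[where g = "\<lambda>x. x - 1"])
          (use j x in \<open>auto intro!: derivative_eq_intros Suc.prems(3)\<close>)
      moreover have "(F j has_real_derivative F (Suc j) x) (at x)"
        using j x by (intro Suc.prems(3)) auto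
      ultimately show ?thesis unfolding F'_def by (auto intro: derivative_eq_intros)
    qed
  qed
  then obtain y where y: "of_int n - real (Suc m) < y" "y < of_int n"
    "(nabla ^^ Suc m) (nabla u) n = F' (Suc m) y" by blast
  have d: "(F (Suc m) has_real_derivative F (Suc (Suc m)) x) (at x)" if "y - 1 \<le> x" "x \<le> y" for x
    using that y by (intro Suc.prems(3)) auto
  obtain x where "y - 1 < x" "x < y" "F (Suc m) y - F (Suc m) (y - 1) = (y - (y - 1)) * F (Suc (Suc m)) x"
    using MVT2[of "y - 1" y "F (Suc m)" "F (Suc (Suc m))"] d by auto
  moreover have "(nabla ^^ Suc (Suc m)) u n = (nabla ^^ Suc m) (nabla u) n"
    by (simp only: funpow_Suc_right o_def)
  ultimately show ?case
    using y by (intro exI[of _ x]) (auto simp: F'_def)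
qed

section \<open>Infinite and finitely supported sums\<close>

lemma infsum_ennreal_le:
  fixes a :: "int \<Rightarrow> ennreal"
  assumes "\<And>N. (\<Sum>n\<in>{k..N}. a n) \<le> B"
  shows "(\<Sum>\<^sub>\<infinity>n\<in>{k..}. a n) \<le> B"
proof (rule infsum_le_finite_sums)
  show "a summable_on {k..}" by (rule nonneg_summable_on_complete) simp
next
  fix F assume F: "finite F" "F \<subseteq> {k..}"
  then obtain N where "\<And>n. n \<in> F \<Longrightarrow> n \<le> N"
    by (meson Max_ge)
  then have "F \<subseteq> {k..N}" using F by auto
  then have "sum a F \<le> sum a {k..N}" by (intro sum_mono2) auto
  also have "\<dots> \<le> B" by (rule assms)
  finally show "sum a F \<le> B" .
qed

lemma sum_le_infsum_ennreal:
  fixes a :: "int \<Rightarrow> ennreal"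
  shows "(\<Sum>n\<in>{k..N}. a n) \<le> (\<Sum>\<^sub>\<infinity>n\<in>{k..}. a n)"
proof -
  have "infsum a {k..N} \<le> infsum a {k..}"
    by (rule infsum_mono_neutral) (auto intro!: nonneg_summable_on_complete)
  then show ?thesis by simp
qed

lemma Sum_any_nabla_funpow_by_parts:
  fixes u v :: "int \<Rightarrow> real"
  assumes u: "finite {n. u n \<noteq> 0}"
  shows "Sum_any (\<lambda>n. (nabla ^^ m) u n * v n) = (-1) ^ m * Sum_any (\<lambda>n. u n * (nabla ^^ m) v (n + int m))"
proof (induction m arbitrary: v)
  case (Suc m)
  let ?x = "(nabla ^^ m) u"
  have fin: "finite {n. ?x n \<noteq> 0}" by (rule finite_support_nabla_funpow[OF u])
  have fin1: "finite {n. ?x n * w n \<noteq> 0}" for w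
    by (rule finite_subset[OF _ fin]) auto
  have fin2: "finite {n. ?x (n - 1) * w n \<noteq> 0}" for w
    by (rule finite_subset[OF _ finite_imageI[OF fin, of "\<lambda>n. n + 1"]])
       (auto simp: image_iff intro!: exI[of _ "_ - 1"])
  have "Sum_any (\<lambda>n. (nabla ^^ Suc m) u n * v n) =
      Sum_any (\<lambda>n. ?x n * v n + ?x (n - 1) * (- v n))"
    by (intro Sum_any.cong) (simp add: nabla_def algebra_simps)
  also have "\<dots> = Sum_any (\<lambda>n. ?x n * v n) + Sum_any (\<lambda>n. ?x (n - 1) * (- v n))"
    by (rule Sum_any.distrib[OF fin1 fin2])
  also have "Sum_any (\<lambda>n. ?x (n - 1) * (- v n)) = Sum_any (\<lambda>n. ?x n * (- v (n + 1)))"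
  proof (rule Sum_any.reindex_cong)
    show "bij (\<lambda>n::int. n + 1)" by (rule bij_plus_right)
  qed (simp add: fun_eq_iff)
  also have "Sum_any (\<lambda>n. ?x n * v n) + Sum_any (\<lambda>n. ?x n * (- v (n + 1))) =
      Sum_any (\<lambda>n. ?x n * v n + ?x n * (- v (n + 1)))"
    by (rule Sum_any.distrib[OF fin1 fin1, symmetric])
  also have "\<dots> = Sum_any (\<lambda>n. ?x n * ((-1) * nabla v (n + 1)))"
    by (intro Sum_any.cong) (simp add: nabla_def algebra_simps)
  also have "\<dots> = (-1) ^ m * Sum_any (\<lambda>n. u n * (nabla ^^ m) (\<lambda>n. (-1) * nabla v (n + 1)) (n + int m))"
    by (rule Suc)
  also have "(\<lambda>n. u n * (nabla ^^ m) (\<lambda>n. (-1) * nabla v (n + 1)) (n + int m)) =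
      (\<lambda>n. (-1) * (u n * (nabla ^^ Suc m) v (n + int (Suc m))))"
    unfolding nabla_funpow_cmult nabla_funpow_shift funpow_Suc_right o_def by (simp add: add_ac)
  also have "Sum_any \<dots> = (-1) * Sum_any (\<lambda>n. u n * (nabla ^^ Suc m) v (n + int (Suc m)))"
    by (rule Sum_any_right_distrib[symmetric], rule finite_subset[OF _ u]) auto
  finally show ?case by simp
qed simp

text \<open>
  This identifies \<open>(-\<Delta>)^m\<close> as \<open>(\<nabla>\<^sup>*)^m \<nabla>^m\<close>. It will be used
  with \<open>v\<close> equal to the ground state near the support of \<open>u\<close>.
\<close>

lemma Sum_any_nabla_funpow_product:
  fixes u v :: "int \<Rightarrow> real"
  assumes "finite {n. u n \<noteq> 0}"
  shows "Sum_any (\<lambda>n. (nabla ^^ m) u n * (nabla ^^ m) v n) = Sum_any (\<lambda>n. u n * (neg_laplacian ^^ m) v n)"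
proof -
  have "(nabla ^^ m) ((nabla ^^ m) v) = (nabla ^^ (2 * m)) v"
    by (simp add: mult_2 funpow_add)
  then have e: "u n * (neg_laplacian ^^ m) v n =
      (-1) ^ m * (u n * (nabla ^^ m) ((nabla ^^ m) v) (n + int m))" for n
    by (simp add: neg_laplacian_funpow)
  have "finite {n. u n * (nabla ^^ m) ((nabla ^^ m) v) (n + int m) \<noteq> 0}"
    by (rule finite_subset[OF _ assms]) auto
  then show ?thesis
    unfolding e Sum_any_nabla_funpow_by_parts[OF assms] by (rule Sum_any_right_distrib)
qed

lemma infsum_ennreal_eq_Sum_any:
  fixes a :: "int \<Rightarrow> real"
  assumes fin: "finite {n. a n \<noteq> 0}" and a: "\<And>n. n < k \<Longrightarrow> a n = 0" "\<And>n. n \<ge> k \<Longrightarrow> a n \<ge> 0"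
  shows "(\<Sum>\<^sub>\<infinity>n\<in>{k..}. ennreal (a n)) = ennreal (Sum_any a)"
proof -
  let ?S = "{n. a n \<noteq> 0}"
  have S: "n \<ge> k" if "a n \<noteq> 0" for n using a(1)[of n] that by (meson not_le)
  have "(\<Sum>\<^sub>\<infinity>n\<in>{k..}. ennreal (a n)) = (\<Sum>\<^sub>\<infinity>n\<in>?S. ennreal (a n))"
    by (rule infsum_cong_neutral) (use S in auto)
  also have "\<dots> = (\<Sum>n\<in>?S. ennreal (a n))" using fin by simp
  also have "\<dots> = ennreal (sum a ?S)"
    by (rule sum_ennreal) (use S a(2) in auto)
  also have "sum a ?S = Sum_any a" by (simp add: Sum_any.expand_set)
  finally show ?thesis .
qed

lemma sum_le_Sum_any:
  fixes a :: "int \<Rightarrow> real"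
  assumes "finite {n. a n \<noteq> 0}" "\<And>n. a n \<ge> 0" "finite A"
  shows "sum a A \<le> Sum_any a"
proof -
  have "Sum_any a = sum a ({n. a n \<noteq> 0} \<union> A)"
    by (rule Sum_any.expand_superset) (use assms in auto)
  also have "\<dots> \<ge> sum a A"
    by (rule sum_mono2) (use assms in auto)
  finally show ?thesis .
qed

lemma Sum_any_square_combination:
  fixes x y w :: "int \<Rightarrow> real"
  assumes "finite {n. x n \<noteq> 0}" "finite {n. y n \<noteq> 0}"
  shows "Sum_any (\<lambda>n. w n * (a * x n + b * y n)\<^sup>2) =
    a\<^sup>2 * Sum_any (\<lambda>n. w n * (x n)\<^sup>2) + 2 * a * b * Sum_any (\<lambda>n. w n * (x n * y n)) + b\<^sup>2 * Sum_any (\<lambda>n. w n * (y n)\<^sup>2)"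
proof -
  let ?A = "{n. x n \<noteq> 0} \<union> {n. y n \<noteq> 0}"
  have e: "Sum_any z = sum z ?A" if "\<And>n. x n = 0 \<Longrightarrow> y n = 0 \<Longrightarrow> z n = 0" for z :: "int \<Rightarrow> real"
    by (rule Sum_any.expand_superset) (use that assms in auto)
  have "Sum_any (\<lambda>n. w n * (a * x n + b * y n)\<^sup>2) = (\<Sum>n\<in>?A. w n * (a * x n + b * y n)\<^sup>2)"
    by (rule e) simp
  also have "\<dots> = (\<Sum>n\<in>?A. a\<^sup>2 * (w n * (x n)\<^sup>2) + 2 * a * b * (w n * (x n * y n)) + b\<^sup>2 * (w n * (y n)\<^sup>2))"
    by (intro sum.cong) (simp_all add: power2_eq_square algebra_simps)
  also have "\<dots> = a\<^sup>2 * (\<Sum>n\<in>?A. w n * (x n)\<^sup>2) + 2 * a * b * (\<Sum>n\<in>?A. w n * (x n * y n)) + b\<^sup>2 * (\<Sum>n\<in>?A. w n * (y n)\<^sup>2)"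
    by (simp only: sum.distrib sum_distrib_left)
  also have "(\<Sum>n\<in>?A. w n * (x n)\<^sup>2) = Sum_any (\<lambda>n. w n * (x n)\<^sup>2)" by (rule e[symmetric]) simp
  also have "(\<Sum>n\<in>?A. w n * (x n * y n)) = Sum_any (\<lambda>n. w n * (x n * y n))" by (rule e[symmetric]) simp
  also have "(\<Sum>n\<in>?A. w n * (y n)\<^sup>2) = Sum_any (\<lambda>n. w n * (y n)\<^sup>2)" by (rule e[symmetric]) simp
  finally show ?thesis .
qed

lemma not_summable_imp_large_sum:
  fixes a :: "int \<Rightarrow> real"
  assumes nn: "\<And>n. n \<ge> k \<Longrightarrow> a n \<ge> 0" and ns: "\<not> a summable_on {k..}" and j: "j \<ge> k"
  shows "\<exists>N. (\<Sum>n\<in>{j..N}. a n) > B"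
proof (rule ccontr)
  assume "\<not> ?thesis"
  then have le: "(\<Sum>n\<in>{j..N}. a n) \<le> B" for N by (simp add: not_less)
  have "a summable_on {j..}"
  proof (rule nonneg_bdd_above_summable_on)
    show "a n \<ge> 0" if "n \<in> {j..}" for n using nn[of n] that j by simp
    show "bdd_above (sum a ` {F. F \<subseteq> {j..} \<and> finite F})"
    proof (rule bdd_aboveI2)
      fix F assume F: "F \<in> {F. F \<subseteq> {j..} \<and> finite F}"
      have "F \<subseteq> {j..Max F}" using F by auto
      then have "sum a F \<le> sum a {j..Max F}"
        using nn j by (intro sum_mono2) auto
      then show "sum a F \<le> B" using le[of "Max F"] by simp
    qed
  qed
  then have "a summable_on ({j..} \<union> {k..<j})"
    by (intro summable_on_Un_disjoint) auto
  moreover have "{j..} \<union> {k..<j} = {k..}" using j by auto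
  ultimately show False using ns by simp
qed

section \<open>The quadratic forms on test sequences\<close>

lemma energy_eq:
  "energy l u = (\<Sum>\<^sub>\<infinity>n\<in>{int l..}. ennreal ((cmod ((nabla ^^ l) u n))\<^sup>2))"
proof -
  have c: "\<lceil>real l / 2\<rceil> + int (l div 2) = int l"
  proof (cases "even l")
    case True
    then show ?thesis by (auto elim!: evenE)
  next
    case False
    then obtain m where l: "l = Suc (2 * m)" by (auto elim!: oddE)
    have "\<lceil>real l / 2\<rceil> = int m + 1" by (rule ceiling_unique) (auto simp: l)
    then show ?thesis by (simp add: l)
  qed
  have bij: "bij_betw (\<lambda>n. n + int (l div 2)) {\<lceil>real l / 2\<rceil>..} {int l..}"
    by (rule bij_betw_byWitness[where f' = "\<lambda>n. n - int (l div 2)"]) (use c in auto)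
  have "energy l u =
      (\<Sum>\<^sub>\<infinity>n\<in>{\<lceil>real l / 2\<rceil>..}. ennreal ((cmod ((nabla ^^ l) u (n + int (l div 2))))\<^sup>2))"
    by (simp add: energy_def half_power_eq_nabla_funpow norm_mult norm_power)
  also have "\<dots> = (\<Sum>\<^sub>\<infinity>n\<in>{int l..}. ennreal ((cmod ((nabla ^^ l) u n))\<^sup>2))"
    by (rule infsum_reindex_bij_betw[OF bij])
  finally show ?thesis .
qed

text \<open>
  The real elements of \<open>H0_space k\<close>; the cutoffs of the ground state are of this kind.
\<close>

definition test_seq :: "int \<Rightarrow> (int \<Rightarrow> real) \<Rightarrow> bool" where
  "test_seq k u \<longleftrightarrow> finite {n. u n \<noteq> 0} \<and> (\<forall>n<k. u n = 0)"

lemma test_seq_combination: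
  assumes "test_seq k u" "test_seq k v"
  shows "test_seq k (\<lambda>n. a * u n + b * v n)"
proof -
  have "{n. a * u n + b * v n \<noteq> 0} \<subseteq> {n. u n \<noteq> 0} \<union> {n. v n \<noteq> 0}" by auto
  then show ?thesis using assms by (auto simp: test_seq_def intro: finite_subset)
qed

lemma test_seq_bound:
  assumes "test_seq k u"
  obtains M where "M \<ge> M0" "\<And>n. n > M \<Longrightarrow> u n = 0"
proof
  let ?M = "Max (insert M0 {n. u n \<noteq> 0})"
  have f: "finite (insert M0 {n. u n \<noteq> 0})" using assms by (simp add: test_seq_def)
  show "?M \<ge> M0" using f by simp
  show "u n = 0" if "n > ?M" for n
  proof (rule ccontr)
    assume "u n \<noteq> 0"
    then have "n \<le> ?M" using f by (intro Max_ge) auto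
    then show False using that by simp
  qed
qed

lemma energy_of_real:
  assumes u: "test_seq (int l) u"
  shows "energy l (\<lambda>n. complex_of_real (u n)) = ennreal (Sum_any (\<lambda>n. ((nabla ^^ l) u n)\<^sup>2))"
proof -
  have "energy l (\<lambda>n. complex_of_real (u n)) = (\<Sum>\<^sub>\<infinity>n\<in>{int l..}. ennreal (((nabla ^^ l) u n)\<^sup>2))"
    by (simp add: energy_eq nabla_funpow_of_real)
  also have "\<dots> = ennreal (Sum_any (\<lambda>n. ((nabla ^^ l) u n)\<^sup>2))"
  proof (rule infsum_ennreal_eq_Sum_any)
    show "finite {n. ((nabla ^^ l) u n)\<^sup>2 \<noteq> 0}"
      using finite_support_nabla_funpow[of u l] u by (simp add: test_seq_def)
    show "((nabla ^^ l) u n)\<^sup>2 = 0" if "n < int l" for n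
      using nabla_funpow_eq_0[of "int l" u n l] u that by (simp add: test_seq_def)
  qed simp
  finally show ?thesis .
qed

lemma weighted_sum_of_real:
  assumes u: "test_seq (int l) u" and w: "\<And>n. n \<ge> int l \<Longrightarrow> w n \<ge> 0"
  shows "weighted_sum l w (\<lambda>n. complex_of_real (u n)) = ennreal (Sum_any (\<lambda>n. w n * (u n)\<^sup>2))"
proof -
  have "finite {n. w n * (u n)\<^sup>2 \<noteq> 0}"
    by (rule finite_subset[of _ "{n. u n \<noteq> 0}"]) (use u in \<open>auto simp: test_seq_def\<close>)
  then show ?thesis unfolding weighted_sum_def
    using infsum_ennreal_eq_Sum_any[of "\<lambda>n. w n * (u n)\<^sup>2" "int l"] u w
    by (simp add: test_seq_def)
qed

lemma of_real_mem_H0_space: "test_seq k u \<Longrightarrow> (\<lambda>n. complex_of_real (u n)) \<in> H0_space k"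
  by (simp add: test_seq_def H0_space_def H_space_def)

section \<open>The chain of weighted Hardy inequalities\<close>

text \<open>
  In the continuum this is \<open>h\<^sup>2 |(v/h)'|\<^sup>2\<close>, which vanishes exactly for multiples of \<open>h\<close>.
\<close>

definition hardy_defect :: "(int \<Rightarrow> real) \<Rightarrow> (int \<Rightarrow> complex) \<Rightarrow> int \<Rightarrow> real" where
  "hardy_defect h v n =
     h n * h (n - 1) * (cmod (v n / of_real (h n) - v (n - 1) / of_real (h (n - 1))))\<^sup>2"

text \<open>
  When \<open>h\<close> vanishes at \<open>n - 1\<close>, division by zero gives \<open>0\<close> in both terms that contain
  \<open>h (n - 1)\<close> as denominator, and the identity survives provided that \<open>v\<close> vanishes there too.
\<close>

lemma picone_identity:
  assumes "h n \<noteq> 0" "h (n - 1) = 0 \<Longrightarrow> v (n - 1) = 0"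
  shows "(cmod (nabla v n))\<^sup>2 =
    nabla h n * ((cmod (v n))\<^sup>2 / h n - (cmod (v (n - 1)))\<^sup>2 / h (n - 1)) + hardy_defect h v n"
proof (cases "h (n - 1) = 0")
  case True
  then show ?thesis using assms by (simp add: nabla_def hardy_defect_def)
next
  case False
  have "(cmod (nabla v n))\<^sup>2 = (Re (v n) - Re (v (n - 1)))\<^sup>2 + (Im (v n) - Im (v (n - 1)))\<^sup>2"
    by (simp add: nabla_def cmod_power2)
  moreover have "(cmod (v n / of_real (h n) - v (n - 1) / of_real (h (n - 1))))\<^sup>2 =
      (Re (v n) / h n - Re (v (n - 1)) / h (n - 1))\<^sup>2 + (Im (v n) / h n - Im (v (n - 1)) / h (n - 1))\<^sup>2"
    by (simp add: cmod_power2 Re_divide_of_real Im_divide_of_real)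
  moreover have "(x - y)\<^sup>2 = (a - b) * (x\<^sup>2 / a - y\<^sup>2 / b) + a * b * (x / a - y / b)\<^sup>2"
    if "a \<noteq> 0" "b \<noteq> 0" for x y a b :: real
    using that by (simp add: field_simps power2_eq_square)
  note this[OF assms(1) False, of "Re (v n)" "Re (v (n - 1))"]
    this[OF assms(1) False, of "Im (v n)" "Im (v (n - 1))"]
  ultimately show ?thesis
    by (simp add: hardy_defect_def cmod_power2 add_divide_distrib algebra_simps nabla_def[of h])
qed

text \<open>
  After Picone's identity, summation by parts moves the difference from \<open>|v|\<^sup>2/h\<close> to \<open>f\<close>. The
  boundary term at \<open>k\<close> vanishes and the one at \<open>N\<close> is nonnegative, so that the truncated sums of
  an arbitrary sequence compare, and with them the infinite ones.
\<close>

lemma weighted_hardy_step: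
  assumes v: "v (k - 1) = 0"
    and h: "h (k - 1) = 0" "\<And>n. n \<ge> k \<Longrightarrow> h n > 0" "\<And>n. n \<ge> k \<Longrightarrow> nabla h n > 0"
    and f: "\<And>n. n \<ge> k \<Longrightarrow> f n \<ge> 0"
  shows "(\<Sum>n\<in>{k..N}. (f n - f (n + 1)) / h n * (cmod (v n))\<^sup>2 + f n / nabla h n * hardy_defect h v n)
         \<le> (\<Sum>n\<in>{k..N}. f n / nabla h n * (cmod (nabla v n))\<^sup>2)"
proof -
  define a where "a n = (cmod (v n))\<^sup>2 / h n" for n
  define X where "X n = (f n - f (n + 1)) / h n * (cmod (v n))\<^sup>2 + f n / nabla h n * hardy_defect h v n" for n
  define Y where "Y n = f n / nabla h n * (cmod (nabla v n))\<^sup>2" for n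
  have Y: "Y n = f n * (a n - a (n - 1)) + f n / nabla h n * hardy_defect h v n" if "n \<ge> k" for n
  proof -
    have z: "v (n - 1) = 0" if "h (n - 1) = 0"
      using h(2)[of "n - 1"] v that \<open>n \<ge> k\<close> by (cases "n = k") auto
    have "(cmod (nabla v n))\<^sup>2 = nabla h n * (a n - a (n - 1)) + hardy_defect h v n"
      unfolding a_def by (rule picone_identity) (use h(2)[OF that] z in auto)
    then have "Y n = f n / nabla h n * (nabla h n * (a n - a (n - 1)) + hardy_defect h v n)"
      by (simp add: Y_def)
    also have "\<dots> = f n * (a n - a (n - 1)) + f n / nabla h n * hardy_defect h v n"
      using h(3)[OF that] by (simp add: distrib_left)
    finally show ?thesis .
  qed
  (* summation by parts, with the boundary term kept *)
  have "(\<Sum>n\<in>{k..N}. Y n) = (\<Sum>n\<in>{k..N}. X n) + f (N + 1) * a N" if "N \<ge> k"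
    using that
  proof (induction N rule: int_ge_induct)
    case base
    have "a (k - 1) = 0" using v by (simp add: a_def)
    with Y[of k] show ?case by (simp add: X_def a_def[of k] algebra_simps diff_divide_distrib)
  next
    case (step N)
    have e: "{k..N + 1} = insert (N + 1) {k..N}" using step by auto
    have "Y (N + 1) + f (N + 1) * a N = X (N + 1) + f (N + 1 + 1) * a (N + 1)"
      using Y[of "N + 1"] step(1)
      by (simp add: X_def a_def algebra_simps diff_divide_distrib)
    then show ?case using step by (simp add: e)
  qed
  moreover have "f (N + 1) * a N \<ge> 0" if "N \<ge> k"
    using f[of "N + 1"] h(2)[of N] that by (simp add: a_def)
  ultimately have "sum X {k..N} \<le> sum Y {k..N}" by (cases "N \<ge> k") auto
  then show ?thesis by (simp add: X_def Y_def)
qed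

text \<open>
  The abstract source of Hardy--Rellich--Birman weights: by the last assumption, taken with
  \<open>k = 0\<close>, and by summation all lower order differences of \<open>g\<close> are positive from \<open>l\<close> on, and the
  higher order differences alternate in sign. The index is shifted by \<open>k\<close> so that the stencil of the
  difference starts at \<open>n - l \<ge> 0\<close>.
\<close>

locale hrb_ground_state =
  fixes l :: nat and g :: "int \<Rightarrow> real"
  assumes order_pos: "l \<ge> 1"
    and g_eq_0: "\<And>n. n < int l \<Longrightarrow> g n = 0"
    and alternating: "\<And>k n. k \<le> l \<Longrightarrow> n \<ge> int l \<Longrightarrow> (-1) ^ k * (nabla ^^ (l + k)) g (n + int k) > 0"
begin

text \<open>
  These are the numbers \<open>(\<nabla>\<^sup>*)^k \<nabla>^l g\<close>, where \<open>(\<nabla>\<^sup>* b)\<^sub>n = b\<^sub>n - b\<^sub>n\<^sub>+\<^sub>1\<close> is the adjoint of \<open>\<nabla>\<close>.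
\<close>

definition flux :: "nat \<Rightarrow> int \<Rightarrow> real" where
  "flux k n = (-1) ^ k * (nabla ^^ (l + k)) g (n + int k)"

definition profile :: "nat \<Rightarrow> int \<Rightarrow> real" where
  "profile k = (nabla ^^ (l - k)) g"

definition rho :: "int \<Rightarrow> real" where
  "rho n = (neg_laplacian ^^ l) g n / g n"

lemma flux_pos: "k \<le> l \<Longrightarrow> n \<ge> int l \<Longrightarrow> flux k n > 0"
  unfolding flux_def by (rule alternating)

lemma flux_diff: "flux k n - flux k (n + 1) = flux (Suc k) n"
proof -
  have "flux (Suc k) n = (-1) ^ Suc k * nabla ((nabla ^^ (l + k)) g) (n + 1 + int k)"
    by (simp add: flux_def algebra_simps)
  then show ?thesis by (simp add: flux_def nabla_def algebra_simps)
qed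

lemma flux_0: "flux 0 = profile 0"
  by (simp add: flux_def profile_def fun_eq_iff)

lemma flux_l: "flux l n = (neg_laplacian ^^ l) g n"
  by (simp add: flux_def neg_laplacian_funpow mult_2)

lemma profile_l: "profile l = g"
  by (simp add: profile_def)

lemma nabla_profile: "k < l \<Longrightarrow> nabla (profile (Suc k)) = profile k"
  by (simp add: profile_def Suc_diff_Suc flip: funpow.simps(2)[THEN fun_cong, unfolded o_def])

lemma profile_eq_0: "n < int l \<Longrightarrow> profile k n = 0"
  unfolding profile_def by (rule nabla_funpow_eq_0[OF g_eq_0])

lemma profile_pos:
  assumes "k \<le> l" "n \<ge> int l"
  shows "profile k n > 0"
  using assms
proof (induction k arbitrary: n)
  case 0
  then show ?case using flux_pos[of 0 n] by (simp add: flux_0)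
next
  case (Suc k)
  from Suc.prems(2) show ?case
  proof (induction n rule: int_ge_induct)
    case base
    have "nabla (profile (Suc k)) (int l) > 0"
      using Suc.IH[of "int l"] Suc.prems by (simp add: nabla_profile)
    then show ?case using profile_eq_0[of "int l - 1" "Suc k"] by (simp add: nabla_def)
  next
    case (step n)
    have "nabla (profile (Suc k)) (n + 1) > 0"
      using Suc.IH[of "n + 1"] Suc.prems step by (simp add: nabla_profile)
    then show ?case using step by (simp add: nabla_def)
  qed
qed

lemma g_pos: "n \<ge> int l \<Longrightarrow> g n > 0"
  using profile_pos[of l n] by (simp add: profile_l)

lemma rho_pos: "n \<ge> int l \<Longrightarrow> rho n > 0"
  using flux_pos[of l n] g_pos[of n] by (simp add: rho_def flux_l)

lemma rho_g: "n \<ge> int l \<Longrightarrow> rho n * g n = (neg_laplacian ^^ l) g n"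
  using g_pos[of n] by (simp add: rho_def)

text \<open>
  The stages of the chain: \<open>k = 0\<close> is the energy and \<open>k = l\<close> the weighted sum.
\<close>

definition level_sum :: "nat \<Rightarrow> (int \<Rightarrow> complex) \<Rightarrow> ennreal" where
  "level_sum k u = (\<Sum>\<^sub>\<infinity>n\<in>{int l..}.
     ennreal (flux k n / profile k n * (cmod ((nabla ^^ (l - k)) u n))\<^sup>2))"

lemma level_sum_0: "level_sum 0 u = energy l u"
proof -
  have "flux 0 n / profile 0 n = 1" if "n \<ge> int l" for n
    using profile_pos[of 0 n] that by (simp add: flux_0)
  then show ?thesis unfolding level_sum_def energy_eq
    by (intro infsum_cong) (simp only: atLeast_iff mult_1_left diff_zero)
qed

lemma level_sum_l: "level_sum l u = weighted_sum l rho u"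
  by (simp add: level_sum_def weighted_sum_def rho_def flux_l profile_l)

definition level_remainder :: "nat \<Rightarrow> (int \<Rightarrow> complex) \<Rightarrow> int \<Rightarrow> real" where
  "level_remainder k u n =
     flux k n / profile k n * hardy_defect (profile (Suc k)) ((nabla ^^ (l - Suc k)) u) n"

lemma profile_nonneg: "k \<le> l \<Longrightarrow> profile k n \<ge> 0"
  using profile_pos[of k n] profile_eq_0[of n k] by (cases "n \<ge> int l") auto

lemma hardy_defect_nonneg: "k \<le> l \<Longrightarrow> hardy_defect (profile k) v n \<ge> 0"
  by (simp add: hardy_defect_def profile_nonneg)

lemma level_remainder_nonneg: "k < l \<Longrightarrow> n \<ge> int l \<Longrightarrow> level_remainder k u n \<ge> 0"
  using flux_pos[of k n] profile_pos[of k n]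
  by (simp add: level_remainder_def hardy_defect_nonneg)

text \<open>
  One Hardy step with \<open>h = profile (k + 1)\<close> and \<open>f = flux k\<close>: the backward difference of \<open>h\<close> is
  \<open>profile k\<close>, and the backward difference of \<open>f\<close> is \<open>flux (k + 1)\<close> up to sign and shift, so that the
  two weights in \<open>weighted_hardy_step\<close> are those of consecutive levels.
\<close>

lemma level_sum_Suc_le:
  assumes k: "k < l" and u: "u \<in> H_space (int l)"
  shows "level_sum (Suc k) u + (\<Sum>\<^sub>\<infinity>n\<in>{int l..}. ennreal (level_remainder k u n)) \<le> level_sum k u"
proof -
  define v where "v = (nabla ^^ (l - Suc k)) u"
  have Dv: "(nabla ^^ (l - k)) u = nabla v"
    using k by (simp add: v_def Suc_diff_Suc flip: funpow.simps(2)[THEN fun_cong, unfolded o_def])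
  define x where "x n = flux (Suc k) n / profile (Suc k) n * (cmod (v n))\<^sup>2" for n
  define y where "y n = flux k n / profile k n * (cmod (nabla v n))\<^sup>2" for n
  have nn: "x n \<ge> 0" "y n \<ge> 0" "level_remainder k u n \<ge> 0" if "n \<ge> int l" for n
    using flux_pos[of k n] profile_pos[of k n] flux_pos[of "Suc k" n] profile_pos[of "Suc k" n]
      level_remainder_nonneg[of k n u] k that
    by (simp_all add: x_def y_def)
  have "(\<Sum>n\<in>{int l..N}. x n + level_remainder k u n) \<le> (\<Sum>n\<in>{int l..N}. y n)" for N
  proof -
    have "(\<Sum>n\<in>{int l..N}. (flux k n - flux k (n + 1)) / profile (Suc k) n * (cmod (v n))\<^sup>2 +
            flux k n / nabla (profile (Suc k)) n * hardy_defect (profile (Suc k)) v n)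
          \<le> (\<Sum>n\<in>{int l..N}. flux k n / nabla (profile (Suc k)) n * (cmod (nabla v n))\<^sup>2)"
    proof (rule weighted_hardy_step)
      show "v (int l - 1) = 0"
        unfolding v_def by (rule nabla_funpow_eq_0[of "int l"]) (use u in \<open>auto simp: H_space_def\<close>)
    qed (use k flux_pos profile_pos profile_eq_0 in \<open>auto simp: nabla_profile less_imp_le\<close>)
    then show ?thesis
      using k by (simp add: x_def y_def level_remainder_def flux_diff nabla_profile v_def)
  qed
  then have le: "(\<Sum>n\<in>{int l..N}. ennreal (x n) + ennreal (level_remainder k u n)) \<le>
      (\<Sum>n\<in>{int l..N}. ennreal (y n))" for N
  proof -
    have "(\<Sum>n\<in>{int l..N}. ennreal (x n) + ennreal (level_remainder k u n)) =
        (\<Sum>n\<in>{int l..N}. ennreal (x n + level_remainder k u n))"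
      using nn by (intro sum.cong) auto
    also have "\<dots> = ennreal (\<Sum>n\<in>{int l..N}. x n + level_remainder k u n)"
      using nn by (intro sum_ennreal) auto
    also have "\<dots> \<le> ennreal (\<Sum>n\<in>{int l..N}. y n)"
      by (rule ennreal_leI) fact
    also have "\<dots> = (\<Sum>n\<in>{int l..N}. ennreal (y n))"
      using nn by (intro sum_ennreal[symmetric]) auto
    finally show ?thesis .
  qed
  have "level_sum (Suc k) u + (\<Sum>\<^sub>\<infinity>n\<in>{int l..}. ennreal (level_remainder k u n)) =
      (\<Sum>\<^sub>\<infinity>n\<in>{int l..}. ennreal (x n) + ennreal (level_remainder k u n))"
    unfolding level_sum_def x_def v_def
    by (rule infsum_add[symmetric]) (auto intro: nonneg_summable_on_complete)
  also have "\<dots> \<le> (\<Sum>\<^sub>\<infinity>n\<in>{int l..}. ennreal (y n))"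
    by (rule infsum_ennreal_le) (rule order.trans[OF le sum_le_infsum_ennreal])
  also have "\<dots> = level_sum k u"
    by (simp add: level_sum_def y_def Dv)
  finally show ?thesis .
qed

lemma level_sum_antimono:
  assumes "u \<in> H_space (int l)" "k \<le> l"
  shows "level_sum k u \<le> energy l u"
  using assms(2)
proof (induction k)
  case 0
  then show ?case by (simp add: level_sum_0)
next
  case (Suc k)
  have "level_sum (Suc k) u \<le> level_sum k u"
    using level_sum_Suc_le[of k u] assms(1) Suc.prems
    by (meson Suc_le_lessD add_increasing2 le_iff_add order.trans zero_le)
  with Suc show ?case by simp
qed

lemma weighted_sum_remainder_le_energy:
  assumes "u \<in> H_space (int l)"
  shows "weighted_sum l rho u + (\<Sum>\<^sub>\<infinity>n\<in>{int l..}. ennreal (level_remainder (l - 1) u n)) \<le> energy l u"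
proof -
  have "Suc (l - 1) = l" using order_pos by simp
  then show ?thesis
    using level_sum_Suc_le[of "l - 1" u] level_sum_antimono[of u "l - 1"] assms order_pos
    by (metis diff_le_self diff_less less_le_trans less_one level_sum_l order.trans zero_less_one)
qed

lemma hrb_weight_rho: "hrb_weight l rho"
  unfolding hrb_weight_def
proof (intro conjI allI impI ballI)
  show "rho n \<ge> 0" if "n \<ge> int l" for n using rho_pos[OF that] by simp
  show "weighted_sum l rho u \<le> energy l u" if "u \<in> H0_space (int l)" for u
    using level_sum_antimono[of u l] that by (simp add: level_sum_l H0_space_def)
qed

text \<open>
  The last step has ground state \<open>profile l = g\<close>, and its remainder measures the increments of
  \<open>u/g\<close>.
\<close>

lemma proportional_if_no_remainder:
  assumes u: "u \<in> H_space (int l)" and r: "\<And>n. n \<ge> int l \<Longrightarrow> level_remainder (l - 1) u n = 0"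
  shows "u n = u (int l) / of_real (g (int l)) * of_real (g n)"
proof (cases "n \<ge> int l")
  case False
  then show ?thesis using u g_eq_0[of n] by (simp add: H_space_def)
next
  case True
  have "u n / of_real (g n) = u (int l) / of_real (g (int l))"
    using True
  proof (induction n rule: int_ge_induct)
    case (step n)
    have "level_remainder (l - 1) u (n + 1) = 0" using r step by simp
    moreover have "flux (l - 1) (n + 1) > 0" "profile (l - 1) (n + 1) > 0" "g n > 0" "g (n + 1) > 0"
      using flux_pos[of "l - 1" "n + 1"] profile_pos[of "l - 1" "n + 1"] g_pos[of n] g_pos[of "n + 1"] step
      by simp_all
    ultimately have "u (n + 1) / of_real (g (n + 1)) = u n / of_real (g n)"
      using order_pos by (simp add: level_remainder_def hardy_defect_def profile_l)
    with step show ?case by simp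
  qed simp
  then show ?thesis using g_pos[OF True] by (simp add: field_simps)
qed

text \<open>
  Equality together with finiteness of the weighted sum leaves nothing for the remainder, hence \<open>u\<close>
  is a multiple of \<open>g\<close>, whose weighted sum diverges.
\<close>

lemma non_attainable_rho:
  assumes div: "\<not> (\<lambda>n. rho n * (g n)\<^sup>2) summable_on {int l..}"
  shows "non_attainable_weight l rho"
  unfolding non_attainable_weight_def
proof (intro ballI impI allI, elim conjE)
  fix u n
  assume u: "u \<in> H_space (int l)"
    and s: "(\<lambda>n. (cmod (complex_of_real (sqrt (rho n)) * u n))\<^sup>2) summable_on {int l..}"
    and eq: "energy l u = weighted_sum l rho u"
  have s': "(\<lambda>n. rho n * (cmod (u n))\<^sup>2) summable_on {int l..}"
    by (rule summable_on_cong[THEN iffD1, OF _ s])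
       (use rho_pos in \<open>auto simp: norm_mult power_mult_distrib less_imp_le\<close>)
  have fin: "weighted_sum l rho u < \<infinity>"
  proof -
    have nn: "rho n * (cmod (u n))\<^sup>2 \<ge> 0" if "n \<ge> int l" for n
      using rho_pos[OF that] by simp
    have "(\<Sum>n\<in>{int l..N}. ennreal (rho n * (cmod (u n))\<^sup>2)) \<le>
        ennreal (\<Sum>\<^sub>\<infinity>n\<in>{int l..}. rho n * (cmod (u n))\<^sup>2)" for N
      using finite_sum_le_infsum[OF s', of "{int l..N}"] nn
      by (subst sum_ennreal) (auto intro!: ennreal_leI)
    then have "weighted_sum l rho u \<le> ennreal (\<Sum>\<^sub>\<infinity>n\<in>{int l..}. rho n * (cmod (u n))\<^sup>2)"
      unfolding weighted_sum_def by (rule infsum_ennreal_le)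
    then show ?thesis by (simp add: order.strict_trans1)
  qed
  have R0: "(\<Sum>\<^sub>\<infinity>n\<in>{int l..}. ennreal (level_remainder (l - 1) u n)) = 0"
    using weighted_sum_remainder_le_energy[OF u] fin unfolding eq
    by (metis add.right_neutral ennreal_add_left_cancel_le infinity_ennreal_def le_zero_eq not_less_iff_gr_or_eq)
  have r: "level_remainder (l - 1) u n = 0" if "n \<ge> int l" for n
  proof -
    have "ennreal (level_remainder (l - 1) u n) \<le> (\<Sum>i\<in>{int l..n}. ennreal (level_remainder (l - 1) u i))"
      using that by (intro member_le_sum) auto
    also have "\<dots> \<le> 0" using sum_le_infsum_ennreal[of _ "int l" n] R0 by metis
    finally show ?thesis
      using level_remainder_nonneg[of "l - 1" n u] order_pos that by (simp add: ennreal_eq_0_iff)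
  qed
  define c where "c = u (int l) / of_real (g (int l))"
  have ug: "u n = c * of_real (g n)" for n
    unfolding c_def by (rule proportional_if_no_remainder[OF u r])
  have "c = 0"
  proof (rule ccontr)
    assume "c \<noteq> 0"
    have "(\<lambda>n. 1 / (cmod c)\<^sup>2 * (rho n * (cmod (u n))\<^sup>2)) summable_on {int l..}"
      by (rule summable_on_cmult_right[OF s'])
    moreover have "1 / (cmod c)\<^sup>2 * (rho n * (cmod (u n))\<^sup>2) = rho n * (g n)\<^sup>2" for n
      using \<open>c \<noteq> 0\<close> by (simp add: ug norm_mult power_mult_distrib)
    ultimately show False using div by simp
  qed
  then show "u n = 0" by (simp add: ug)
qed

end

section \<open>Criticality and optimality near infinity\<close>

context hrb_ground_state
begin

definition deficit :: "(int \<Rightarrow> real) \<Rightarrow> real" where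
  "deficit u = Sum_any (\<lambda>n. ((nabla ^^ l) u n)\<^sup>2) - Sum_any (\<lambda>n. rho n * (u n)\<^sup>2)"

text \<open>
  This form of the deficit shows that only the places where \<open>u\<close> fails to solve
  \<open>(-\<Delta>)^l u = \<rho> u\<close> contribute.
\<close>

lemma deficit_eq:
  assumes "test_seq (int l) u"
  shows "deficit u = Sum_any (\<lambda>n. u n * ((neg_laplacian ^^ l) u n - rho n * u n))"
proof -
  have fin: "finite {n. u n * w n \<noteq> 0}" for w
    by (rule finite_subset[of _ "{n. u n \<noteq> 0}"]) (use assms in \<open>auto simp: test_seq_def\<close>)
  have "Sum_any (\<lambda>n. u n * ((neg_laplacian ^^ l) u n - rho n * u n)) + Sum_any (\<lambda>n. u n * (rho n * u n)) =
      Sum_any (\<lambda>n. u n * ((neg_laplacian ^^ l) u n - rho n * u n) + u n * (rho n * u n))"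
    by (rule Sum_any.distrib[OF fin fin, symmetric])
  also have "\<dots> = Sum_any (\<lambda>n. u n * (neg_laplacian ^^ l) u n)"
    by (intro Sum_any.cong) (simp add: algebra_simps)
  also have "\<dots> = Sum_any (\<lambda>n. ((nabla ^^ l) u n)\<^sup>2)"
    using Sum_any_nabla_funpow_product[of u l u] assms by (simp add: test_seq_def power2_eq_square)
  also have "Sum_any (\<lambda>n. u n * (rho n * u n)) = Sum_any (\<lambda>n. rho n * (u n)\<^sup>2)"
    by (intro Sum_any.cong) (simp add: power2_eq_square)
  finally show ?thesis by (simp add: deficit_def)
qed

lemma neg_laplacian_funpow_eq_rho:
  assumes v: "\<And>n. n \<le> N \<Longrightarrow> v n = g n" and n: "int l \<le> n" "n + int l \<le> N"
  shows "(neg_laplacian ^^ l) v n = rho n * v n"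
proof -
  have "(nabla ^^ (2 * l)) v (n + int l) = (nabla ^^ (2 * l)) g (n + int l)"
    by (rule nabla_funpow_cong) (use v n in auto)
  then have "(neg_laplacian ^^ l) v n = (neg_laplacian ^^ l) g n"
    by (simp add: neg_laplacian_funpow)
  then show ?thesis using rho_g[of n] v[of n] n by simp
qed

text \<open>
  The polarised deficit form is \<open>\<Sum>n. u\<^sub>n ((-\<Delta>)^l v - \<rho> v)\<^sub>n\<close>; it vanishes because \<open>v\<close> solves the
  ground state equation on the support of \<open>u\<close>.
\<close>

lemma deficit_combination:
  assumes u: "test_seq (int l) u" and v: "test_seq (int l) v"
    and supp: "\<And>n. n > M \<Longrightarrow> u n = 0" and vg: "\<And>n. n \<le> M + int l \<Longrightarrow> v n = g n"
  shows "deficit (\<lambda>n. a * u n + b * v n) = a\<^sup>2 * deficit u + b\<^sup>2 * deficit v"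
proof -
  have fin: "finite {n. u n \<noteq> 0}" "finite {n. v n \<noteq> 0}" using u v by (simp_all add: test_seq_def)
  have Dab: "(nabla ^^ l) (\<lambda>n. a * u n + b * v n) = (\<lambda>n. a * (nabla ^^ l) u n + b * (nabla ^^ l) v n)"
    by (rule ext) (simp add: nabla_funpow_add nabla_funpow_cmult)
  have "Sum_any (\<lambda>n. (nabla ^^ l) u n * (nabla ^^ l) v n) = Sum_any (\<lambda>n. u n * (neg_laplacian ^^ l) v n)"
    by (rule Sum_any_nabla_funpow_product[OF fin(1)])
  also have "\<dots> = Sum_any (\<lambda>n. rho n * (u n * v n))"
  proof (rule Sum_any.cong)
    fix n
    show "u n * (neg_laplacian ^^ l) v n = rho n * (u n * v n)"
    proof (cases "u n = 0")
      case False
      then have "int l \<le> n" "n \<le> M" using u supp by (force simp: test_seq_def not_less[symmetric])+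
      then show ?thesis using neg_laplacian_funpow_eq_rho[of "M + int l" v n] vg by simp
    qed simp
  qed
  finally have "Sum_any (\<lambda>n. 1 * ((nabla ^^ l) u n * (nabla ^^ l) v n)) = Sum_any (\<lambda>n. rho n * (u n * v n))"
    by simp
  then show ?thesis
    unfolding deficit_def Dab
    using Sum_any_square_combination[OF fin, of rho a b]
      Sum_any_square_combination[OF finite_support_nabla_funpow[OF fin(1), of l]
        finite_support_nabla_funpow[OF fin(2), of l], of "\<lambda>_. 1" a b]
    by (simp add: algebra_simps)
qed

text \<open>
  Averaging orthogonal vectors: the mean of \<open>k + 1\<close> pairwise orthogonal sequences of deficit at most
  \<open>C\<close> has deficit at most \<open>C / (k + 1)\<close>. The mean is built up one cutoff at a time, each new one being
  equal to \<open>g\<close> far beyond the support of the previous mean.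
\<close>

lemma small_deficit:
  assumes cutoff: "\<And>N. \<exists>u. test_seq (int l) u \<and> (\<forall>n\<le>N. u n = g n) \<and> deficit u \<le> C"
  shows "\<exists>u. test_seq (int l) u \<and> (\<forall>n\<le>N. u n = g n) \<and> deficit u \<le> C / (real k + 1)"
proof (induction k)
  case 0
  then show ?case using cutoff[of N] by simp
next
  case (Suc k)
  then obtain u where u: "test_seq (int l) u" "\<And>n. n \<le> N \<Longrightarrow> u n = g n" "deficit u \<le> C / (real k + 1)"
    by blast
  obtain M where M: "M \<ge> N" "\<And>n. n > M \<Longrightarrow> u n = 0" using test_seq_bound[OF u(1)] by blast
  obtain v where v: "test_seq (int l) v" "\<And>n. n \<le> M + int l \<Longrightarrow> v n = g n" "deficit v \<le> C"
    using cutoff[of "M + int l"] by blast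
  define t where "t = real k + 1"
  have t: "t > 0" by (simp add: t_def)
  (* the weights turn a mean of k + 1 cutoffs into a mean of k + 2 of them *)
  define w where "w n = t / (t + 1) * u n + 1 / (t + 1) * v n" for n
  have "deficit w = (t / (t + 1))\<^sup>2 * deficit u + (1 / (t + 1))\<^sup>2 * deficit v"
    unfolding w_def by (rule deficit_combination[OF u(1) v(1) M(2) v(2)])
  also have "\<dots> \<le> (t / (t + 1))\<^sup>2 * (C / t) + (1 / (t + 1))\<^sup>2 * C"
    using u(3) v(3) by (intro add_mono mult_left_mono) (auto simp: t_def)
  also have "\<dots> = C * (t + 1) / (t + 1)\<^sup>2"
    using t by (simp add: power_divide power2_eq_square add_divide_distrib algebra_simps)
  also have "\<dots> = C / (t + 1)" using t by (simp add: power2_eq_square)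
  finally have "deficit w \<le> C / (t + 1)" .
  moreover have "w n = g n" if "n \<le> N" for n
  proof -
    have "w n = (t / (t + 1) + 1 / (t + 1)) * g n"
      using u(2)[OF that] v(2)[of n] M(1) that by (simp add: w_def distrib_right)
    also have "t / (t + 1) + 1 / (t + 1) = 1" using t by (simp flip: add_divide_distrib)
    finally show ?thesis by simp
  qed
  moreover have "test_seq (int l) w" unfolding w_def by (rule test_seq_combination[OF u(1) v(1)])
  ultimately show ?case by (intro exI[of _ w]) (simp add: t_def add_ac)
qed

text \<open>
  A larger weight would have to fit the excess \<open>(w\<^sub>m - \<rho>\<^sub>m) g\<^sub>m\<^sup>2\<close> into the deficit of every test
  sequence that equals \<open>g\<close> up to \<open>m\<close>, and this deficit can be made arbitrarily small.
\<close>

lemma critical_rho: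
  assumes cutoff: "\<And>N. \<exists>u. test_seq (int l) u \<and> (\<forall>n\<le>N. u n = g n) \<and> deficit u \<le> C"
  shows "critical_weight l rho"
  unfolding critical_weight_def
proof (intro allI impI, elim conjE)
  fix w m
  assume w: "hrb_weight l w" and ge: "\<forall>n\<ge>int l. rho n \<le> w n" and m: "int l \<le> m"
  have bound: "(w m - rho m) * (g m)\<^sup>2 \<le> C / (real k + 1)" for k
  proof -
    obtain u where u: "test_seq (int l) u" "\<And>n. n \<le> m \<Longrightarrow> u n = g n" "deficit u \<le> C / (real k + 1)"
      using small_deficit[OF cutoff, of m k] by blast
    have fin: "finite {n. z n * (u n)\<^sup>2 \<noteq> 0}" for z :: "int \<Rightarrow> real"
      by (rule finite_subset[of _ "{n. u n \<noteq> 0}"]) (use u(1) in \<open>auto simp: test_seq_def\<close>)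
    have "weighted_sum l w (\<lambda>n. complex_of_real (u n)) \<le> energy l (\<lambda>n. complex_of_real (u n))"
      using w of_real_mem_H0_space[OF u(1)] by (auto simp: hrb_weight_def)
    moreover have "Sum_any (\<lambda>n. ((nabla ^^ l) u n)\<^sup>2) \<ge> 0"
      by (simp add: Sum_any.expand_set sum_nonneg)
    ultimately have le: "Sum_any (\<lambda>n. w n * (u n)\<^sup>2) \<le> Sum_any (\<lambda>n. ((nabla ^^ l) u n)\<^sup>2)"
      using w u(1) by (simp add: energy_of_real weighted_sum_of_real hrb_weight_def)
    have nn: "(w n - rho n) * (u n)\<^sup>2 \<ge> 0" for n
      using ge u(1) by (cases "n \<ge> int l") (auto simp: test_seq_def)
    have "(w m - rho m) * (g m)\<^sup>2 = (\<Sum>n\<in>{m}. (w n - rho n) * (u n)\<^sup>2)"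
      using u(2) by simp
    also have "\<dots> \<le> Sum_any (\<lambda>n. (w n - rho n) * (u n)\<^sup>2)"
      by (rule sum_le_Sum_any[OF fin nn]) simp
    also have "\<dots> = Sum_any (\<lambda>n. w n * (u n)\<^sup>2) - Sum_any (\<lambda>n. rho n * (u n)\<^sup>2)"
    proof -
      have "Sum_any (\<lambda>n. (w n - rho n) * (u n)\<^sup>2) + Sum_any (\<lambda>n. rho n * (u n)\<^sup>2) =
          Sum_any (\<lambda>n. (w n - rho n) * (u n)\<^sup>2 + rho n * (u n)\<^sup>2)"
        by (rule Sum_any.distrib[OF fin fin, symmetric])
      also have "\<dots> = Sum_any (\<lambda>n. w n * (u n)\<^sup>2)"
        by (intro Sum_any.cong) (simp add: algebra_simps)
      finally show ?thesis by simp
    qed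
    also have "\<dots> \<le> deficit u" using le by (simp add: deficit_def)
    finally show ?thesis using u(3) by simp
  qed
  have "(w m - rho m) * (g m)\<^sup>2 \<le> 0"
  proof (rule ccontr)
    assume "\<not> ?thesis"
    then have d: "(w m - rho m) * (g m)\<^sup>2 > 0" (is "?d > 0") by simp
    obtain k where "C / ?d < real k" using reals_Archimedean2 by blast
    then have "C < ?d * real k" using d by (simp add: divide_less_eq mult.commute)
    then have "C < ?d * (real k + 1)" using d by (simp add: distrib_left)
    moreover have "?d * (real k + 1) \<le> C" using bound[of k] by (simp add: le_divide_eq)
    ultimately show False by simp
  qed
  then show "w m = rho m"
    using g_pos[OF m] ge m by (auto simp: mult_le_0_iff)
qed

text \<open>
  The difference of two nested cutoffs vanishes up to \<open>M\<close> and has deficit at most \<open>2 C\<close>, but it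
  equals \<open>g\<close> on an interval so long that \<open>\<epsilon>\<close> times its weighted sum exceeds \<open>2 C\<close>.
\<close>

lemma optimal_near_infinity_rho:
  assumes cutoff: "\<And>N. \<exists>u. test_seq (int l) u \<and> (\<forall>n\<le>N. u n = g n) \<and> deficit u \<le> C"
    and div: "\<not> (\<lambda>n. rho n * (g n)\<^sup>2) summable_on {int l..}"
  shows "optimal_near_infinity l rho"
  unfolding optimal_near_infinity_def
proof (intro allI impI)
  fix M :: int and \<epsilon> :: real
  assume M: "int l \<le> M" and \<epsilon>: "\<epsilon> > 0"
  obtain u where u: "test_seq (int l) u" "\<And>n. n \<le> M \<Longrightarrow> u n = g n" "deficit u \<le> C"
    using cutoff[of M] by blast
  obtain K where K: "K \<ge> M" "\<And>n. n > K \<Longrightarrow> u n = 0" using test_seq_bound[OF u(1)] by blast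
  obtain N where N: "(\<Sum>n\<in>{K + 1..N}. rho n * (g n)\<^sup>2) > 2 * C / \<epsilon>"
  proof -
    have "rho n * (g n)\<^sup>2 \<ge> 0" if "n \<ge> int l" for n using rho_pos[OF that] by simp
    moreover have "K + 1 \<ge> int l" using K(1) M by simp
    ultimately show ?thesis using not_summable_imp_large_sum[OF _ div] that by blast
  qed
  obtain v where v: "test_seq (int l) v" "\<And>n. n \<le> max (K + int l) N \<Longrightarrow> v n = g n" "deficit v \<le> C"
    using cutoff[of "max (K + int l) N"] by blast
  define w where "w n = (-1) * u n + 1 * v n" for n
  have "deficit w = (-1)\<^sup>2 * deficit u + 1\<^sup>2 * deficit v"
    unfolding w_def by (rule deficit_combination[OF u(1) v(1) K(2)]) (use v(2) in auto)
  then have Q: "deficit w \<le> 2 * C" using u(3) v(3) by simp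
  have w: "test_seq (int l) w" unfolding w_def by (rule test_seq_combination[OF u(1) v(1)])
  have w0: "w n = 0" if "n < M" for n
    using u(2)[of n] v(2)[of n] K(1) that by (simp add: w_def)
  have wM: "test_seq M w" using w w0 by (simp add: test_seq_def)
  define W where "W = Sum_any (\<lambda>n. rho n * (w n)\<^sup>2)"
  have "(\<Sum>n\<in>{K + 1..N}. rho n * (g n)\<^sup>2) = (\<Sum>n\<in>{K + 1..N}. rho n * (w n)\<^sup>2)"
    using K(2) v(2) by (intro sum.cong) (auto simp: w_def)
  also have "\<dots> \<le> W"
    unfolding W_def
  proof (rule sum_le_Sum_any)
    show "finite {n. rho n * (w n)\<^sup>2 \<noteq> 0}"
      by (rule finite_subset[of _ "{n. w n \<noteq> 0}"]) (use w in \<open>auto simp: test_seq_def\<close>)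
    show "rho n * (w n)\<^sup>2 \<ge> 0" for n
      using w rho_pos[of n] by (cases "n \<ge> int l") (auto simp: test_seq_def)
  qed simp
  finally have "2 * C / \<epsilon> < W" using N by simp
  then have "\<epsilon> * W > 2 * C" using \<epsilon> by (simp add: divide_less_eq mult.commute)
  then have lt: "Sum_any (\<lambda>n. ((nabla ^^ l) w n)\<^sup>2) < (1 + \<epsilon>) * W"
    using Q by (simp add: deficit_def W_def algebra_simps)
  have E0: "Sum_any (\<lambda>n. ((nabla ^^ l) w n)\<^sup>2) \<ge> 0"
    by (simp add: Sum_any.expand_set sum_nonneg)
  have "energy l (\<lambda>n. complex_of_real (w n)) = ennreal (Sum_any (\<lambda>n. ((nabla ^^ l) w n)\<^sup>2))"
    by (rule energy_of_real[OF w])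
  also have "\<dots> < ennreal ((1 + \<epsilon>) * W)"
    using lt E0 by (simp add: ennreal_lessI)
  also have "\<dots> = ennreal (1 + \<epsilon>) * ennreal W"
    using \<epsilon> by (intro ennreal_mult') simp
  also have "ennreal W = weighted_sum l rho (\<lambda>n. complex_of_real (w n))"
    unfolding W_def by (rule weighted_sum_of_real[OF w, symmetric]) (use rho_pos in \<open>auto simp: less_imp_le\<close>)
  finally show "\<exists>u\<in>H0_space M. energy l u < ennreal (1 + \<epsilon>) * weighted_sum l rho u"
    using of_real_mem_H0_space[OF wM] by blast
qed

end

section \<open>Spline cutoffs\<close>

definition avg :: "nat \<Rightarrow> (int \<Rightarrow> real) \<Rightarrow> int \<Rightarrow> real" where
  "avg N u n = (\<Sum>i<N. u (n - int i)) / real N"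

text \<open>
  The indicator function of a half-line, smoothed by \<open>m\<close> moving averages of length \<open>N\<close>: a discrete
  spline that descends from \<open>1\<close> to \<open>0\<close> over a distance of at most \<open>m N\<close>.
\<close>

definition cutoff :: "nat \<Rightarrow> nat \<Rightarrow> int \<Rightarrow> int \<Rightarrow> real" where
  "cutoff N m K = (avg N ^^ m) (\<lambda>n. if n \<le> K then 1 else 0)"

lemma nabla_avg: "nabla (avg N u) n = (u n - u (n - int N)) / real N"
proof -
  have "nabla (avg N u) n = (\<Sum>i<N. u (n - int i) - u (n - int (Suc i))) / real N"
    by (simp add: nabla_def avg_def sum_subtractf diff_divide_distrib algebra_simps)
  also have "(\<Sum>i<N. u (n - int i) - u (n - int (Suc i))) = u n - u (n - int N)"
    using sum_lessThan_telescope'[of "\<lambda>i. u (n - int i)" N] by simp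
  finally show ?thesis .
qed

text \<open>
  The difference of a moving average is \<open>1/N\<close> times the difference of two translates
  (\<open>nabla_avg\<close>), so each average pays for one difference with a factor \<open>2/N\<close>.
\<close>

lemma abs_nabla_funpow_cutoff_le:
  assumes N: "N \<ge> 1" and "j \<le> m"
  shows "\<bar>(nabla ^^ j) (cutoff N m K) n\<bar> \<le> (2 / real N) ^ j"
  using assms(2)
proof (induction m arbitrary: j n)
  case 0
  then show ?case by (simp add: cutoff_def)
next
  case (Suc m)
  let ?v = "cutoff N m K"
  have e: "cutoff N (Suc m) K = avg N ?v" by (simp add: cutoff_def)
  show ?case
  proof (cases j)
    case 0
    have "\<bar>\<Sum>i<N. ?v (n - int i)\<bar> \<le> (\<Sum>i<N. 1)"
      using Suc.IH[of 0] by (intro order.trans[OF sum_abs] sum_mono) simp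
    then show ?thesis using N by (simp add: e 0 avg_def divide_le_eq)
  next
    case (Suc i)
    have "(nabla ^^ j) (avg N ?v) n = (nabla ^^ i) (nabla (avg N ?v)) n"
      unfolding Suc by (simp only: funpow_Suc_right o_def)
    also have "nabla (avg N ?v) = (\<lambda>n. 1 / real N * (?v n + (-1) * ?v (n + (- int N))))"
      by (rule ext) (simp add: nabla_avg)
    also have "(nabla ^^ i) \<dots> n = 1 / real N * ((nabla ^^ i) ?v n - (nabla ^^ i) ?v (n - int N))"
      unfolding nabla_funpow_cmult nabla_funpow_add nabla_funpow_shift by simp
    also have "\<bar>\<dots>\<bar> \<le> 1 / real N * ((2 / real N) ^ i + (2 / real N) ^ i)"
      unfolding abs_mult using Suc.IH[of i] Suc.prems Suc
      by (intro mult_mono order.trans[OF abs_triangle_ineq4] add_mono) auto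
    also have "\<dots> = (2 / real N) ^ j" using N by (simp add: Suc)
    finally show ?thesis by (simp add: e)
  qed
qed

lemma cutoff_eq_1: "N \<ge> 1 \<Longrightarrow> n \<le> K \<Longrightarrow> cutoff N m K n = 1"
proof (induction m arbitrary: n)
  case (Suc m)
  then have "(\<Sum>i<N. cutoff N m K (n - int i)) = real N" by simp
  with Suc.prems show ?case by (simp add: cutoff_def avg_def)
qed (simp add: cutoff_def)

lemma cutoff_eq_0: "n > K + int m * int N \<Longrightarrow> cutoff N m K n = 0"
proof (induction m arbitrary: n)
  case (Suc m)
  then have "(\<Sum>i<N. cutoff N m K (n - int i)) = 0"
    by (intro sum.neutral ballI Suc.IH) (auto simp: algebra_simps)
  then show ?case by (simp add: cutoff_def avg_def)
qed (simp add: cutoff_def)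

text \<open>
  Leibniz' rule in the form of an estimate. Translates occur only on the factor \<open>a\<close>, which is why the
  bounds on \<open>b\<close> are needed at the single point \<open>n\<close>.
\<close>

lemma abs_nabla_funpow_mult_le:
  fixes a b :: "int \<Rightarrow> real"
  assumes "t \<ge> 0" "A \<ge> 0" "B \<ge> 0"
    and "\<And>i n. i \<le> m \<Longrightarrow> \<bar>(nabla ^^ i) a n\<bar> \<le> A * t ^ i"
    and "\<And>i. i \<le> m \<Longrightarrow> \<bar>(nabla ^^ i) b n\<bar> \<le> B * t ^ i"
  shows "\<bar>(nabla ^^ m) (\<lambda>n. a n * b n) n\<bar> \<le> A * B * (2 * t) ^ m"
  using assms
proof (induction m arbitrary: a b A B)
  case 0
  from 0(4)[of 0 n] 0(5)[of 0] 0(1-3) show ?case by (simp add: abs_mult mult_mono)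
next
  case (Suc m)
  have S: "(nabla ^^ i) (nabla w) n = (nabla ^^ Suc i) w n" for i n and w :: "int \<Rightarrow> real"
    by (simp only: funpow_Suc_right o_def)
  have "nabla (\<lambda>n. a n * b n) = (\<lambda>n. nabla a n * b n + a (n + (-1)) * nabla b n)"
    by (rule ext) (simp add: nabla_def algebra_simps)
  then have "(nabla ^^ Suc m) (\<lambda>n. a n * b n) n =
      (nabla ^^ m) (\<lambda>n. nabla a n * b n) n + (nabla ^^ m) (\<lambda>n. a (n + (-1)) * nabla b n) n"
    unfolding S[symmetric] by (simp only: nabla_funpow_add)
  also have "\<bar>\<dots>\<bar> \<le> (A * t) * B * (2 * t) ^ m + A * (B * t) * (2 * t) ^ m"
  proof (rule order.trans[OF abs_triangle_ineq add_mono])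
    show "\<bar>(nabla ^^ m) (\<lambda>n. nabla a n * b n) n\<bar> \<le> (A * t) * B * (2 * t) ^ m"
      using Suc.prems Suc.prems(4)[of "Suc _"] by (intro Suc.IH) (auto simp: S mult.assoc simp del: funpow.simps)
    show "\<bar>(nabla ^^ m) (\<lambda>n. a (n + (-1)) * nabla b n) n\<bar> \<le> A * (B * t) * (2 * t) ^ m"
      using Suc.prems Suc.prems(5)[of "Suc _"]
      by (intro Suc.IH) (auto simp: S nabla_funpow_shift mult.assoc simp del: funpow.simps add_uminus_conv_diff)
  qed
  also have "\<dots> = A * B * (2 * t) ^ Suc m" by (simp add: algebra_simps)
  finally show ?case .
qed

section \<open>The ground state with half-integer powers\<close>

text \<open>
  The coefficient that \<open>i\<close> differentiations of \<open>x^(k - 1/2)\<close> produce.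
\<close>

definition half_falling :: "nat \<Rightarrow> nat \<Rightarrow> real" where
  "half_falling k i = (\<Prod>j<i. real k - 1 / 2 - real j)"

text \<open>
  The \<open>i\<close>-th derivative of the interpolation of \<open>g_seq l\<close> to real arguments. The sum starts at
  \<open>k = 1\<close> because \<open>x^(-1/2)\<close> would destroy continuity at \<open>0\<close>.
\<close>

definition g_deriv :: "nat \<Rightarrow> nat \<Rightarrow> real \<Rightarrow> real" where
  "g_deriv l i x = (\<Sum>k\<in>{1..l}. (-1) ^ (l + k) * real (stirling l k) * half_falling k i * x powr (real k - 1 / 2 - real i))"

text \<open>
  The first \<open>k\<close> factors are positive, the remaining ones negative.
\<close>

lemma half_falling_sign:
  assumes "k \<le> i"
  shows "(-1) ^ (i + k) * half_falling k i > 0"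
  using assms
proof (induction i rule: dec_induct)
  case base
  have "half_falling k k > 0" unfolding half_falling_def by (rule prod_pos) auto
  then show ?case by simp
next
  case (step i)
  have "(-1) ^ (Suc i + k) * half_falling k (Suc i) = ((-1) ^ (i + k) * half_falling k i) * (real i + 1 / 2 - real k)"
    by (simp add: half_falling_def algebra_simps)
  also have "\<dots> > 0" by (rule mult_pos_pos[OF step(3)]) (use step(1) in simp)
  finally show ?case .
qed

lemma has_real_derivative_g_deriv:
  assumes "x > 0"
  shows "(g_deriv l i has_real_derivative g_deriv l (Suc i) x) (at x)"
proof -
  have d: "((\<lambda>x. x powr (real k - 1 / 2 - real i)) has_real_derivative
      (real k - 1 / 2 - real i) * x powr (real k - 1 / 2 - real (Suc i))) (at x)" for k
    using has_real_derivative_powr[OF assms, of "real k - 1 / 2 - real i"] by (simp add: algebra_simps)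
  show ?thesis
    unfolding g_deriv_def half_falling_def
    by (rule derivative_eq_intros d refl sum.cong | simp add: algebra_simps)+
qed

lemma continuous_on_g_deriv_0: "continuous_on {0..} (g_deriv l 0)"
  unfolding g_deriv_def by (intro continuous_intros continuous_on_powr') auto

text \<open>
  The product is a rising factorial in \<open>-n\<close>, with Stirling numbers as coefficients.
\<close>

lemma g_seq_eq_g_deriv:
  assumes l: "l \<ge> 1" and n: "n \<ge> 0"
  shows "g_seq l n = g_deriv l 0 (of_int n)"
proof (cases "n = 0")
  case True
  then show ?thesis by (simp add: g_seq_def g_deriv_def)
next
  case False
  define x where "x = real_of_int n"
  have x: "x > 0" using n False by (simp add: x_def)
  have "x * (\<Prod>j\<in>{1..<l}. x - real j) = (\<Prod>j<l. x - real j)"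
    using l by (subst lessThan_atLeast0, subst prod.atLeast_Suc_lessThan) auto
  also have "\<dots> = (-1) ^ l * pochhammer (- x) l"
    by (induction l) (simp_all add: pochhammer_Suc algebra_simps)
  also have "pochhammer (- x) l = (\<Sum>k\<le>l. real (stirling l k) * (- x) ^ k)"
    by (rule stirling_pochhammer[symmetric])
  also have "\<dots> = (\<Sum>k\<in>{1..l}. real (stirling l k) * (- x) ^ k)"
    using l by (intro sum.mono_neutral_right) (auto simp: not_le Suc_le_eq)
  also have "(-1) ^ l * \<dots> = (\<Sum>k\<in>{1..l}. (-1) ^ (l + k) * real (stirling l k) * x ^ k)"
    by (simp add: sum_distrib_left power_add power_minus[of x] algebra_simps)
  finally have e: "x * (\<Prod>j\<in>{1..<l}. x - real j) = (\<Sum>k\<in>{1..l}. (-1) ^ (l + k) * real (stirling l k) * x ^ k)" .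
  have "g_seq l n = x powr (- 1 / 2) * (x * (\<Prod>j\<in>{1..<l}. x - real j))"
  proof -
    have "x powr (- 1 / 2) * x = x powr (- 1 / 2) * x powr 1" using x by simp
    also have "\<dots> = sqrt x" unfolding powr_add[symmetric] using x by (simp add: powr_half_sqrt)
    finally show ?thesis using n by (simp add: g_seq_def x_def mult.assoc[symmetric])
  qed
  also have "\<dots> = (\<Sum>k\<in>{1..l}. (-1) ^ (l + k) * real (stirling l k) * (x ^ k * x powr (- 1 / 2)))"
    unfolding e sum_distrib_left by (intro sum.cong) (simp_all add: mult_ac)
  also have "\<dots> = g_deriv l 0 x"
    unfolding g_deriv_def half_falling_def using x
    by (intro sum.cong) (simp_all add: powr_realpow[symmetric] powr_add[symmetric])
  finally show ?thesis by (simp add: x_def)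
qed

lemma nabla_funpow_g_seq_mean_value:
  assumes "l \<ge> 1" "m \<ge> 1" "n \<ge> int m"
  shows "\<exists>x. of_int n - real m < x \<and> x < of_int n \<and> (nabla ^^ m) (g_seq l) n = g_deriv l m x"
proof -
  obtain k where k: "m = Suc k" using assms(2) by (cases m) auto
  show ?thesis
    unfolding k
  proof (rule nabla_funpow_mean_value)
    show "g_seq l i = g_deriv l 0 (of_int i)" if "n - int (Suc k) \<le> i" for i
      using assms that k by (intro g_seq_eq_g_deriv) auto
    show "continuous_on {of_int n - real (Suc k)..of_int n} (g_deriv l 0)"
      by (rule continuous_on_subset[OF continuous_on_g_deriv_0]) (use assms k in auto)
    show "(g_deriv l j has_real_derivative g_deriv l (Suc j) x) (at x)"
      if "of_int n - real (Suc k) < x" for j x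
      using assms that k by (intro has_real_derivative_g_deriv) linarith
  qed
qed

text \<open>
  From order \<open>l\<close> on all terms have the same sign, and the left-hand side is the one with \<open>k = l\<close>.
\<close>

lemma g_deriv_lower_bound:
  assumes "l \<ge> 1" "l \<le> i" "x > 0"
  shows "(-1) ^ (i + l) * half_falling l i * x powr (real l - 1 / 2 - real i) \<le> (-1) ^ (i + l) * g_deriv l i x"
proof -
  define T where "T k = ((-1) ^ (i + k) * half_falling k i) * (real (stirling l k) * x powr (real k - 1 / 2 - real i))" for k
  have "(-1) ^ (i + l) * g_deriv l i x = (\<Sum>k\<in>{1..l}. T k)"
    unfolding g_deriv_def sum_distrib_left
  proof (rule sum.cong)
    fix k
    have sgn: "(-1 :: real) ^ (i + k) = (-1) ^ (i + l) * (-1) ^ (l + k)"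
      by (simp add: power_add)
    show "(-1) ^ (i + l) * ((-1) ^ (l + k) * real (stirling l k) * half_falling k i * x powr (real k - 1 / 2 - real i)) = T k"
      unfolding T_def sgn by (simp only: mult_ac)
  qed simp
  moreover have "T l \<le> (\<Sum>k\<in>{1..l}. T k)"
  proof (rule member_le_sum)
    show "T k \<ge> 0" if "k \<in> {1..l} - {l}" for k
      unfolding T_def by (rule mult_nonneg_nonneg[OF less_imp_le[OF half_falling_sign]]) (use that assms in auto)
  qed (use assms in auto)
  ultimately show ?thesis by (simp add: T_def)
qed

lemma g_deriv_sign:
  assumes "l \<ge> 1" "l \<le> i" "x > 0"
  shows "(-1) ^ (i + l) * g_deriv l i x > 0"
proof -
  have "(-1) ^ (i + l) * half_falling l i * x powr (real l - 1 / 2 - real i) > 0"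
    by (rule mult_pos_pos[OF half_falling_sign[OF assms(2)]]) (use assms(3) in simp)
  then show ?thesis using g_deriv_lower_bound[OF assms] by linarith
qed

lemma g_seq_eq_0:
  assumes "n < int l"
  shows "g_seq l n = 0"
proof (cases "n > 0")
  case True
  then have "nat n \<in> {1..<l}" "real_of_int n - real (nat n) = 0" using assms by auto
  then have "(\<Prod>j\<in>{1..<l}. real_of_int n - real j) = 0"
    by (metis finite_atLeastLessThan prod_zero)
  then show ?thesis by (simp add: g_seq_def)
next
  case False
  then show ?thesis by (cases "n = 0") (auto simp: g_seq_def)
qed

text \<open>
  The difference of order \<open>l + k\<close> at \<open>n + k\<close> only uses arguments from \<open>n - l \<ge> 0\<close> on, where \<open>g_seq l\<close>
  is interpolated by a smooth function whose derivative of this order has a sign.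
\<close>

lemma hrb_ground_state_g_seq:
  assumes l: "l \<ge> 1"
  shows "hrb_ground_state l (g_seq l)"
proof
  fix k n assume k: "k \<le> l" and n: "int l \<le> n"
  obtain x where x: "of_int (n + int k) - real (l + k) < x"
    "(nabla ^^ (l + k)) (g_seq l) (n + int k) = g_deriv l (l + k) x"
    using nabla_funpow_g_seq_mean_value[of l "l + k" "n + int k"] l n by auto
  have "x > 0" using x(1) n by simp
  then have "(-1) ^ (l + k + l) * g_deriv l (l + k) x > 0" by (intro g_deriv_sign) (use l in auto)
  moreover have "(-1 :: real) ^ (l + k + l) = (-1) ^ k" by (simp add: power_add)
  ultimately show "(-1) ^ k * (nabla ^^ (l + k)) (g_seq l) (n + int k) > 0"
    using x(2) by simp
qed (use l g_seq_eq_0 in auto)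

lemma not_summable_on_inverse_int: "\<not> (\<lambda>n. 1 / real_of_int n) summable_on {int k..}"
proof
  assume s: "(\<lambda>n. 1 / real_of_int n) summable_on {int k..}"
  have bij: "bij_betw (\<lambda>i. int (i + k)) UNIV {int k..}"
    by (rule bij_betw_byWitness[where f' = "\<lambda>n. nat (n - int k)"]) auto
  have "(\<lambda>i. 1 / real_of_int (int (i + k))) summable_on UNIV"
    using summable_on_reindex_bij_betw[OF bij, of "\<lambda>n. 1 / real_of_int n"] s by simp
  then have "summable (\<lambda>i. 1 / real_of_int (int (i + k)))"
    by (rule summable_on_imp_summable)
  then have "summable (\<lambda>i. inverse (real (i + k)))" by (simp add: inverse_eq_divide)
  then have "summable (\<lambda>i. inverse (real i))" by (subst (asm) summable_iff_shift)
  then show False using not_summable_harmonic by blast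
qed

text \<open>
  In terms of size, \<open>g\<close> grows like \<open>n^(l-1/2)\<close> and \<open>(-\<Delta>)^l g\<close> decays like its derivative of order
  \<open>2 l\<close>, that is like \<open>n^(-l-1/2)\<close>.
\<close>

lemma rho_weight_g_seq_lower_bound:
  assumes l: "l \<ge> 1"
  obtains c where "c > 0" "\<And>n. n \<ge> int l \<Longrightarrow> c / of_int n \<le> rho_weight l n * (g_seq l n)\<^sup>2"
proof
  define a where "a = (-1) ^ (2 * l + l) * half_falling l (2 * l)"
  define p where "p = - real l - 1 / 2"
  have a: "a > 0" unfolding a_def by (rule half_falling_sign) simp
  define c where "c = a * 2 powr p / real l ^ (l - 1)"
  show "c > 0" using a l by (simp add: c_def)
  fix n assume n: "n \<ge> int l"
  define y where "y = real_of_int n"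
  have y: "y \<ge> real l" "y > 0" using n l by (simp_all add: y_def)
  interpret hrb_ground_state l "g_seq l" by (rule hrb_ground_state_g_seq[OF l])
  obtain x where x: "y - real l < x" "x < y + real l"
    "(nabla ^^ (2 * l)) (g_seq l) (n + int l) = g_deriv l (2 * l) x"
    using nabla_funpow_g_seq_mean_value[of l "2 * l" "n + int l"] l n by (auto simp: y_def)
  have x0: "x > 0" using x(1) y by simp
  have e: "(neg_laplacian ^^ l) (g_seq l) n = (-1) ^ (2 * l + l) * g_deriv l (2 * l) x"
    unfolding neg_laplacian_funpow x(3) by (simp add: power_add power_mult)
  have "a * (2 * y) powr p \<le> a * x powr p"
    using a x0 x(2) y(1) by (intro mult_left_mono powr_mono2') (auto simp: p_def)
  also have "\<dots> = (-1) ^ (2 * l + l) * half_falling l (2 * l) * x powr (real l - 1 / 2 - real (2 * l))"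
    by (simp add: a_def p_def)
  also have "\<dots> \<le> (neg_laplacian ^^ l) (g_seq l) n"
    unfolding e by (rule g_deriv_lower_bound) (use l x0 in auto)
  finally have L: "a * (2 * y) powr p \<le> (neg_laplacian ^^ l) (g_seq l) n" .
  have "(y / real l) ^ (l - 1) = (\<Prod>j\<in>{1..<l}. y / real l)" by simp
  also have "\<dots> \<le> (\<Prod>j\<in>{1..<l}. y - real j)"
  proof (rule prod_mono)
    fix j assume j: "j \<in> {1..<l}"
    (* for y at least l, the worst factor y - (l - 1) is still at least y / l *)
    have "y * (1 - 1 / real l) \<ge> real l * (1 - 1 / real l)"
      using y l by (intro mult_right_mono) auto
    then have "y - y / real l \<ge> real l - 1" using l by (simp add: right_diff_distrib)
    moreover have "real j \<le> real l - 1" using j by auto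
    ultimately show "0 \<le> y / real l \<and> y / real l \<le> y - real j" using y by auto
  qed
  finally have G: "sqrt y * (y / real l) ^ (l - 1) \<le> g_seq l n"
    using n l y by (simp add: g_seq_def y_def mult_left_mono)
  have "c / y = a * (2 * y) powr p * (sqrt y * (y / real l) ^ (l - 1))"
  proof -
    have "y powr p * (sqrt y * y ^ (l - 1)) = y powr (p + (1 / 2 + real (l - 1)))"
      using y by (simp add: powr_add powr_half_sqrt powr_realpow)
    also have "p + (1 / 2 + real (l - 1)) = - 1" using l by (simp add: p_def of_nat_diff)
    also have "y powr (- 1) = 1 / y" using y by (simp add: powr_minus_divide)
    finally have "1 / y = y powr p * (sqrt y * y ^ (l - 1))" by simp
    then have "c * (1 / y) = c * (y powr p * (sqrt y * y ^ (l - 1)))" by (rule arg_cong)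
    then show ?thesis using y by (simp add: c_def powr_mult power_divide)
  qed
  also have "\<dots> \<le> (neg_laplacian ^^ l) (g_seq l) n * g_seq l n"
    using L G a y by (intro mult_mono) (auto intro: order.trans[OF _ L])
  also have "\<dots> = rho_weight l n * (g_seq l n)\<^sup>2"
    using g_pos[OF n] by (simp add: rho_weight_def power2_eq_square)
  finally show "c / of_int n \<le> rho_weight l n * (g_seq l n)\<^sup>2" by (simp add: y_def)
qed

lemma not_summable_rho_weight_g_seq:
  assumes l: "l \<ge> 1"
  shows "\<not> (\<lambda>n. rho_weight l n * (g_seq l n)\<^sup>2) summable_on {int l..}"
proof
  assume s: "(\<lambda>n. rho_weight l n * (g_seq l n)\<^sup>2) summable_on {int l..}"
  obtain c where c: "c > 0" "\<And>n. n \<ge> int l \<Longrightarrow> c / of_int n \<le> rho_weight l n * (g_seq l n)\<^sup>2"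
    using rho_weight_g_seq_lower_bound[OF l] by blast
  have "(\<lambda>n. c / real_of_int n) summable_on {int l..}"
    by (rule summable_on_comparison_test[OF s]) (use c l in auto)
  then have "(\<lambda>n. 1 / c * (c / real_of_int n)) summable_on {int l..}"
    by (rule summable_on_cmult_right)
  then show False using c(1) not_summable_on_inverse_int[of l] by simp
qed

lemma g_deriv_upper_bound:
  assumes c: "c \<ge> 1" and y: "y > 0" "y \<le> x" "x \<le> c * y" and y1: "y \<ge> 1"
  shows "\<bar>g_deriv l j x\<bar> \<le>
    (\<Sum>k\<in>{1..l}. real (stirling l k) * \<bar>half_falling k j\<bar>) * (c ^ l * (y ^ l * y powr (- 1 / 2) / y ^ j))"
proof -
  define T where "T = c ^ l * (y ^ l * y powr (- 1 / 2) / y ^ j)"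
  have x: "x > 0" using y by simp
  have t: "x powr (real k - 1 / 2 - real j) \<le> T" if k: "k \<le> l" for k
  proof -
    have "x powr (real k - 1 / 2 - real j) = x ^ k * x powr (- 1 / 2 - real j)"
    proof -
      have "real k - 1 / 2 - real j = real k + (- 1 / 2 - real j)" by simp
      then show ?thesis using x by (simp only: powr_add powr_realpow)
    qed
    also have "\<dots> \<le> (c * y) ^ l * y powr (- 1 / 2 - real j)"
    proof (rule mult_mono)
      have "x ^ k \<le> (c * y) ^ k" using x y by (intro power_mono) auto
      also have "\<dots> \<le> (c * y) ^ l" using c y1 k mult_mono[of 1 c 1 y] by (intro power_increasing) auto
      finally show "x ^ k \<le> (c * y) ^ l" .
      show "x powr (- 1 / 2 - real j) \<le> y powr (- 1 / 2 - real j)"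
        using y by (intro powr_mono2') auto
    qed (use c y in auto)
    also have "\<dots> = T"
      using y by (simp add: T_def power_mult_distrib powr_diff powr_realpow)
    finally show ?thesis .
  qed
  have "\<bar>g_deriv l j x\<bar> \<le> (\<Sum>k\<in>{1..l}. real (stirling l k) * \<bar>half_falling k j\<bar> * x powr (real k - 1 / 2 - real j))"
    unfolding g_deriv_def by (rule order.trans[OF sum_abs]) (simp add: abs_mult)
  also have "\<dots> \<le> (\<Sum>k\<in>{1..l}. real (stirling l k) * \<bar>half_falling k j\<bar> * T)"
    using t by (intro sum_mono mult_left_mono) auto
  finally show ?thesis by (simp only: T_def sum_distrib_right)
qed

text \<open>
  Each difference gains a factor \<open>1/N\<close> in a window comparable to \<open>N\<close>. The distance \<open>2 l\<close> from the
  left end of the window keeps the intermediate points of the mean value theorem inside it.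
\<close>

lemma nabla_funpow_g_seq_upper_bound:
  assumes l: "l \<ge> 1" and c: "c \<ge> 1"
  obtains C where "C \<ge> 0"
    "\<And>j N n. j \<le> 2 * l \<Longrightarrow> N \<ge> 1 \<Longrightarrow> int N + 2 * int l \<le> n \<Longrightarrow> of_int n \<le> c * real N \<Longrightarrow>
       \<bar>(nabla ^^ j) (g_seq l) n\<bar> \<le> C * (real N ^ l * real N powr (- 1 / 2) / real N ^ j)"
proof
  define A where "A j = (\<Sum>k\<in>{1..l}. real (stirling l k) * \<bar>half_falling k j\<bar>)" for j
  define C where "C = (\<Sum>j\<le>2 * l. A j) * c ^ l"
  have A: "A j \<ge> 0" for j by (auto simp: A_def intro!: sum_nonneg)
  show "C \<ge> 0" using A c by (auto simp: C_def intro!: mult_nonneg_nonneg sum_nonneg)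
  fix j N n
  assume j: "j \<le> 2 * l" and N: "N \<ge> 1" and n: "int N + 2 * int l \<le> n" "of_int n \<le> c * real N"
  have "\<exists>x. real N \<le> x \<and> x \<le> c * real N \<and> (nabla ^^ j) (g_seq l) n = g_deriv l j x"
  proof (cases "j = 0")
    case True
    then show ?thesis using g_seq_eq_g_deriv[OF l, of n] n
      by (intro exI[of _ "of_int n"]) auto
  next
    case False
    obtain x where "of_int n - real j < x" "x < of_int n" "(nabla ^^ j) (g_seq l) n = g_deriv l j x"
      using nabla_funpow_g_seq_mean_value[OF l, of j n] j n False by auto
    then show ?thesis using j n by (intro exI[of _ x]) auto
  qed
  then obtain x where x: "real N \<le> x" "x \<le> c * real N" "(nabla ^^ j) (g_seq l) n = g_deriv l j x" by blast
  have "\<bar>(nabla ^^ j) (g_seq l) n\<bar> \<le> A j * (c ^ l * (real N ^ l * real N powr (- 1 / 2) / real N ^ j))"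
    unfolding x(3) A_def by (rule g_deriv_upper_bound) (use c x N in auto)
  also have "\<dots> \<le> (\<Sum>j\<le>2 * l. A j) * (c ^ l * (real N ^ l * real N powr (- 1 / 2) / real N ^ j))"
    using A c j by (intro mult_right_mono member_le_sum) auto
  finally show "\<bar>(nabla ^^ j) (g_seq l) n\<bar> \<le> C * (real N ^ l * real N powr (- 1 / 2) / real N ^ j)"
    by (simp add: C_def)
qed

lemma rho_g_seq: "l \<ge> 1 \<Longrightarrow> hrb_ground_state.rho l (g_seq l) = rho_weight l"
  by (simp add: fun_eq_iff rho_weight_def hrb_ground_state.rho_def[OF hrb_ground_state_g_seq])

text \<open>
  The cutoff of \<open>g\<close> on the scale \<open>N\<close> violates the ground state equation at \<open>O(N)\<close> places only. At each
  of them the sequence is \<open>O(N^(l-1/2))\<close> and its image under \<open>(-\<Delta>)^l\<close> is \<open>O(N^(-l-1/2))\<close>, and the powers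
  of \<open>N\<close> cancel in the sum.
\<close>

lemma bounded_deficit_cutoffs:
  assumes l: "l \<ge> 1"
  obtains C where "\<And>N0. \<exists>u. test_seq (int l) u \<and> (\<forall>n\<le>N0. u n = g_seq l n) \<and>
    hrb_ground_state.deficit l (g_seq l) u \<le> C"
proof -
  interpret hrb_ground_state l "g_seq l" by (rule hrb_ground_state_g_seq[OF l])
  (* wide enough for the support of the cutoff, which ends at N + 3 l + 2 l N, plus l *)
  define c where "c = 6 * real l + 1"
  obtain C where C: "C \<ge> 0"
    "\<And>j N n. j \<le> 2 * l \<Longrightarrow> N \<ge> 1 \<Longrightarrow> int N + 2 * int l \<le> n \<Longrightarrow> of_int n \<le> c * real N \<Longrightarrow>
       \<bar>(nabla ^^ j) (g_seq l) n\<bar> \<le> C * (real N ^ l * real N powr (- 1 / 2) / real N ^ j)"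
    using nabla_funpow_g_seq_upper_bound[OF l, of c] by (auto simp: c_def)
  show ?thesis
  proof (rule that)
    fix N0 :: int
    define N where "N = nat (max 1 N0)"
    have N: "N \<ge> 1" "N0 \<le> int N" by (auto simp: N_def)
    have lN: "real l \<le> real l * real N"
      using mult_left_mono[of 1 "real N" "real l"] N(1) by simp
    (* Differences of order 2 l at n + l matter for n > K - l; the offset 3 l keeps
       such n and n + l beyond N + 2 l, as required by the bounds on g. *)
    define K where "K = int N + 3 * int l"
    define \<xi> where "\<xi> = cutoff N (2 * l) K"
    define u where "u n = \<xi> n * g_seq l n" for n
    define B where "B = C * (real N ^ l * real N powr (- 1 / 2))"
    have B: "B \<ge> 0" using C(1) by (simp add: B_def)
    have u_eq: "u n = g_seq l n" if "n \<le> K" for n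
      using that N by (simp add: u_def \<xi>_def cutoff_eq_1)
    have u0: "u n = 0" if "n > K + 2 * int l * int N" for n
      using that by (simp add: u_def \<xi>_def cutoff_eq_0)
    have ul: "u n = 0" if "n < int l" for n using that by (simp add: u_def g_eq_0)
    have test: "test_seq (int l) u"
    proof -
      have "{n. u n \<noteq> 0} \<subseteq> {int l..K + 2 * int l * int N}" using u0 ul by (force simp: not_less[symmetric])
      then show ?thesis using ul by (auto simp: test_seq_def intro: finite_subset)
    qed
    define S where "S = {K - int l<..K + 2 * int l * int N}"
    have S_le: "of_int n + real l \<le> c * real N" if "n \<in> S" for n
    proof -
      have "real_of_int n \<le> of_int (K + 2 * int l * int N)" using that unfolding S_def of_int_le_iff by simp
      then have "of_int n + real l \<le> real N + 4 * real l + 2 * real l * real N" by (simp add: K_def)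
      also have "\<dots> \<le> real N + 4 * (real l * real N) + 2 * real l * real N"
        using lN by (simp add: mult.commute)
      finally show ?thesis by (simp add: c_def algebra_simps)
    qed
    have gB: "\<bar>(nabla ^^ j) (g_seq l) n\<bar> \<le> B * (2 / real N) ^ j"
      if "j \<le> 2 * l" "K - int l < n" "of_int n \<le> c * real N" for j n
    proof -
      have "\<bar>(nabla ^^ j) (g_seq l) n\<bar> \<le> B * (1 / real N) ^ j"
        using C(2)[OF that(1) N(1) _ that(3)] that(2) by (simp add: B_def K_def power_divide)
      also have "\<dots> \<le> B * (2 / real N) ^ j"
        using B by (intro mult_left_mono power_mono divide_right_mono) auto
      finally show ?thesis .
    qed
    have term_le: "u n * ((neg_laplacian ^^ l) u n - rho n * u n) \<le> B * (B * (4 / real N) ^ (2 * l))"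
      if n: "n \<in> S" for n
    proof -
      have nl: "n \<ge> int l" using n by (simp add: S_def K_def)
      have "u n * ((neg_laplacian ^^ l) u n - rho n * u n) = u n * (neg_laplacian ^^ l) u n - rho n * (u n)\<^sup>2"
        by (simp add: power2_eq_square algebra_simps)
      (* the potential only lowers the deficit *)
      also have "\<dots> \<le> u n * (neg_laplacian ^^ l) u n" using rho_pos[OF nl] by simp
      also have "\<dots> \<le> \<bar>u n\<bar> * \<bar>(neg_laplacian ^^ l) u n\<bar>" by (simp flip: abs_mult)
      also have "\<dots> \<le> B * (B * (4 / real N) ^ (2 * l))"
      proof (rule mult_mono)
        have "\<bar>u n\<bar> \<le> 1 * B"
          unfolding u_def abs_mult
        proof (rule mult_mono)
          show "\<bar>\<xi> n\<bar> \<le> 1" using abs_nabla_funpow_cutoff_le[OF N(1), of 0 "2 * l" K n] by (simp add: \<xi>_def)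
          show "\<bar>g_seq l n\<bar> \<le> B" using gB[of 0 n] n S_le[OF n] by (simp add: S_def)
        qed auto
        then show "\<bar>u n\<bar> \<le> B" by simp
        have "\<bar>(nabla ^^ (2 * l)) u (n + int l)\<bar> \<le> 1 * B * (2 * (2 / real N)) ^ (2 * l)"
          unfolding u_def
        proof (rule abs_nabla_funpow_mult_le)
          show "\<bar>(nabla ^^ i) \<xi> m\<bar> \<le> 1 * (2 / real N) ^ i" if "i \<le> 2 * l" for i m
            using abs_nabla_funpow_cutoff_le[OF N(1) that] by (simp add: \<xi>_def)
          show "\<bar>(nabla ^^ i) (g_seq l) (n + int l)\<bar> \<le> B * (2 / real N) ^ i" if "i \<le> 2 * l" for i
            using gB[OF that, of "n + int l"] n S_le[OF n] by (simp add: S_def)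
        qed (use B in auto)
        then show "\<bar>(neg_laplacian ^^ l) u n\<bar> \<le> B * (4 / real N) ^ (2 * l)"
          by (simp add: neg_laplacian_funpow abs_mult)
      qed (use B in auto)
      finally show ?thesis .
    qed
    have "deficit u = Sum_any (\<lambda>n. u n * ((neg_laplacian ^^ l) u n - rho n * u n))"
      by (rule deficit_eq[OF test])
    also have "\<dots> = (\<Sum>n\<in>S. u n * ((neg_laplacian ^^ l) u n - rho n * u n))"
    proof (rule Sum_any.expand_superset)
      show "finite S" by (simp add: S_def)
      show "{n. u n * ((neg_laplacian ^^ l) u n - rho n * u n) \<noteq> 0} \<subseteq> S"
      proof
        fix n assume "n \<in> {n. u n * ((neg_laplacian ^^ l) u n - rho n * u n) \<noteq> 0}"
        then have nz: "u n \<noteq> 0" "(neg_laplacian ^^ l) u n \<noteq> rho n * u n" by auto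
        have "n \<le> K + 2 * int l * int N" using u0[of n] nz(1) by (meson not_le)
        moreover have "n \<ge> int l" using ul[of n] nz(1) by (meson not_le)
        then have "\<not> n + int l \<le> K" using neg_laplacian_funpow_eq_rho[of K u n] u_eq nz(2) by blast
        ultimately show "n \<in> S" by (simp add: S_def)
      qed
    qed
    also have "\<dots> \<le> real (card S) * (B * (B * (4 / real N) ^ (2 * l)))"
      by (rule sum_bounded_above) (rule term_le)
    also have "\<dots> \<le> (3 * real l * real N) * (B * (B * (4 / real N) ^ (2 * l)))"
    proof (rule mult_right_mono)
      have "real (card S) = real l + 2 * real l * real N" by (simp add: S_def nat_add_distrib nat_mult_distrib)
      also have "\<dots> \<le> real l * real N + 2 * real l * real N" using lN by (simp add: mult.commute)
      finally show "real (card S) \<le> 3 * real l * real N" by (simp add: mult_ac)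
    qed (use B in auto)
    also have "\<dots> = 3 * real l * C\<^sup>2 * 4 ^ (2 * l)"
    proof -
      have r: "real N > 0" using N by simp
      have "real N powr (- 1 / 2) * real N powr (- 1 / 2) = 1 / real N"
        unfolding powr_add[symmetric] using r by (simp add: powr_minus_divide)
      moreover have "real N ^ (2 * l) = real N ^ l * real N ^ l" by (simp only: mult_2 power_add)
      ultimately have "B * B = C\<^sup>2 * real N ^ (2 * l) / real N"
        by (simp add: B_def power2_eq_square algebra_simps)
      then have "B * (B * (4 / real N) ^ (2 * l)) = C\<^sup>2 * real N ^ (2 * l) / real N * (4 / real N) ^ (2 * l)"
        by (simp add: mult.assoc[symmetric])
      also have "\<dots> = C\<^sup>2 * 4 ^ (2 * l) / real N" using r by (simp add: power_divide)
      finally show ?thesis using r by simp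
    qed
    finally have "deficit u \<le> 3 * real l * C\<^sup>2 * 4 ^ (2 * l)" .
    moreover have "\<forall>n\<le>N0. u n = g_seq l n" using N(2) u_eq by (simp add: K_def)
    ultimately show "\<exists>u. test_seq (int l) u \<and> (\<forall>n\<le>N0. u n = g_seq l n) \<and> deficit u \<le> 3 * real l * C\<^sup>2 * 4 ^ (2 * l)"
      using test by blast
  qed
qed

theorem theorem4:
  fixes l :: nat
  assumes "l \<ge> 1"
  shows "(\<forall>n\<ge>int l. rho_weight l n > 0) \<and> optimal_hrb_weight l (rho_weight l)"
proof -
  interpret hrb_ground_state l "g_seq l" by (rule hrb_ground_state_g_seq[OF assms])
  have rho: "rho_weight l = rho" using rho_g_seq[OF assms] by simp
  have div: "\<not> (\<lambda>n. rho n * (g_seq l n)\<^sup>2) summable_on {int l..}"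
    using not_summable_rho_weight_g_seq[OF assms] unfolding rho .
  obtain C where C: "\<And>N0. \<exists>u. test_seq (int l) u \<and> (\<forall>n\<le>N0. u n = g_seq l n) \<and> deficit u \<le> C"
    using bounded_deficit_cutoffs[OF assms] by blast
  show ?thesis
    unfolding rho optimal_hrb_weight_def
    using rho_pos hrb_weight_rho critical_rho[OF C] non_attainable_rho[OF div]
      optimal_near_infinity_rho[OF C div] by blast
qed

end
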